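(* Let $p$ be a probability distribution on $\nabla'$, let $(\sigma_n)_{n\ge1}$ be a random virtual permutation generated from a random vector with law $p$, and let $(u_j)_{j\ge1}$ be a sequence of i.i.d. uniform random variables on the unit circle, independent of $(\sigma_n)_{n\ge1}$. One can couple $((\sigma_n)_{n\ge1},(u_j)_{j\ge1})$ with a random sequence of matrices $(\widetilde M_n)_{n\ge1}$ which is almost surely a modified virtual permutation, such that for all $n\ge1$: - $\widetilde M_n$ is a random modified permutation matrix corresponding to $\sigma_n$, i.e. the non-zero entries of $\widetilde M_n$ are located at the positions $(\sigma_n(j),j)$, $1\le j\le n$, and are i.i.d. random variables uniformly distributed on the unit circle; - denoting by $\ell_{n,j}$ the cycle-lengths of $\sigma_n$, for all $j$ and $n$ such that $\ell_{n,j}>0$, $u_j$ is the product of the non-zero entries of $\widetilde M_n$ corresponding to the cycle $j$ of $\sigma_n$.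
   Context: $\nabla'=\{(\lambda_1,\lambda_2,\dots)\in[0,1]^\infty:\lambda_1\ge\lambda_2\ge\cdots,\ \sum_{j\ge1}\lambda_j=1\}$. A virtual permutation is a sequence $(\sigma_n)_{n\ge1}$, $\sigma_n\in\mathfrak{S}_n$, such that $\sigma_n$ is obtained from $\sigma_{n+1}$ by removing the element $n+1$ from its decomposition into disjoint cycles. Random virtual permutations are generated as follows: let $y$ have law $p$ on $\nabla'$, let $E_y=\bigsqcup_{j\ge1}\mathcal{C}_j$ be a disjoint union of circles, $\mathcal{C}_j$ of perimeter $y_j$, and conditionally on $y$ let $(x_k)_{k\ge1}$ be i.i.d. uniform on $E_y$; for $k\le n$ with $x_k\in\mathcal{C}_j$, $\sigma_n(k)$ is the index of the first point of $\{x_1,\dots,x_n\}$ met after $x_k$ following $\mathcal{C}_j$ counterclockwise (so $\sigma_n(k)=k$ if $x_k$ is alone on $\mathcal{C}_j$). The cycle $j$ of $\sigma_n$ is the one supported by $\{k\le n:x_k\in\mathcal{C}_j\}$, whose cardinality is $\ell_{n,j}$ (no cycle if $\ell_{n,j}=0$). The sequence $(u_j)$ is taken independent of $(y,(x_k)_{k\ge1})$. A modified permutation matrix is a permutation matrix whose entries equal to one are replaced by complex numbers of modulus one; it corresponds to the permutation $\tau$ if its non-zero entries are at the positions $(\tau(j),j)$. $\mathcal{T}_n$ is the set of $n\times n$ modified permutation matrices not having $1$ as an eigenvalue. A sequence $(\widetilde M_n)_{n\ge1}$ is a modified virtual permutation if for all $n$, $\widetilde M_n\in\mathcal{T}_n$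 and $\mathrm{rank}(\widetilde M_{n+1}-\mathrm{diag}(\widetilde M_n,1))=1$, where $\mathrm{diag}(\widetilde M_n,1)$ is the $(n+1)\times(n+1)$ block diagonal matrix. *)

theory Defs
  imports
    "HOL-Probability.Probability"
    "HOL-Combinatorics.Permutations"
    "Jordan_Normal_Form.Char_Poly"
    "Jordan_Normal_Form.DL_Rank"
begin

(* Conventions: permutations of size n act on {..<n}, sample points and circles are numbered
   from 0, and matrix indices start at 0 as in Jordan_Normal_Form.Matrix. *)

definition nabla' :: "(nat \<Rightarrow> real) set" where
  "nabla' = {y. (\<forall>j. 0 \<le> y j \<and> y j \<le> 1) \<and> decseq y \<and> y sums 1}"

definition nabla'_algebra :: "(nat \<Rightarrow> real) measure" where
  "nabla'_algebra = restrict_space (\<Pi>\<^sub>M j\<in>UNIV. borel) nabla'"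

definition unif_circle :: "complex measure" where
  "unif_circle = distr (uniform_measure lborel {0..<2 * pi}) borel cis"


subsection \<open>Random virtual permutations\<close>

text \<open>A point of the disjoint union of circles with perimeters \<open>y 0, y 1, \<dots>\<close> is a pair \<open>(j, t)\<close>:
  the number of its circle, and its position along that circle, read counterclockwise from an
  origin. A circle of perimeter zero has no points.\<close>

definition circles :: "(nat \<Rightarrow> real) \<Rightarrow> (nat \<times> real) set" where
  "circles y = (SIGMA j:UNIV. {0..<y j})"

definition unif_circles :: "(nat \<Rightarrow> real) \<Rightarrow> (nat \<times> real) measure" where
  "unif_circles y = uniform_measure (count_space UNIV \<Otimes>\<^sub>M lborel) (circles y)"

text \<open>The distance travelled counterclockwise from position \<open>s\<close> until position \<open>t\<close> is met on a circle
  of perimeter \<open>L\<close>. Going from \<open>s\<close> to itself takes a full turn, so that a point is its own successor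
  only if it is alone on its circle.\<close>

definition ccw_dist :: "real \<Rightarrow> real \<Rightarrow> real \<Rightarrow> real" where
  "ccw_dist L s t = (if s < t then t - s else t - s + L)"

text \<open>The choice made by \<open>arg_min\<close> is forced when the points are pairwise distinct, hence almost
  surely.\<close>

definition circle_perm :: "(nat \<Rightarrow> real) \<Rightarrow> (nat \<Rightarrow> nat \<times> real) \<Rightarrow> nat \<Rightarrow> nat \<Rightarrow> nat" where
  "circle_perm y x n k =
     (if k < n
      then arg_min (\<lambda>i. ccw_dist (y (fst (x k))) (snd (x k)) (snd (x i)))
                   (\<lambda>i. i < n \<and> fst (x i) = fst (x k))
      else k)"

definition cycle_supp :: "(nat \<Rightarrow> nat \<times> real) \<Rightarrow> nat \<Rightarrow> nat \<Rightarrow> nat set" where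
  "cycle_supp x n j = {k. k < n \<and> fst (x k) = j}"

definition cycle_length :: "(nat \<Rightarrow> nat \<times> real) \<Rightarrow> nat \<Rightarrow> nat \<Rightarrow> nat" where
  "cycle_length x n j = card (cycle_supp x n j)"

text \<open>On the probability space \<open>\<Omega>\<close>, the vector \<open>y\<close> has law \<open>p\<close> and, conditionally on \<open>y\<close>, the points
  \<open>x k\<close> are i.i.d. uniform on \<open>circles y\<close>. The conditional law is prescribed through its
  finite-dimensional rectangles.\<close>

definition generates_virtual_perm ::
  "'a measure \<Rightarrow> (nat \<Rightarrow> real) measure \<Rightarrow> ('a \<Rightarrow> nat \<Rightarrow> real) \<Rightarrow> ('a \<Rightarrow> nat \<Rightarrow> nat \<times> real) \<Rightarrow> bool" where
  "generates_virtual_perm \<Omega> p y x \<longleftrightarrow>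
     y \<in> measurable \<Omega> p \<and> distr \<Omega> p y = p \<and>
     (\<forall>k. (\<lambda>\<omega>. x \<omega> k) \<in> measurable \<Omega> (count_space UNIV \<Otimes>\<^sub>M borel)) \<and>
     (\<forall>A\<in>sets p. \<forall>n. \<forall>B.
        (\<forall>k<n. B k \<in> sets (count_space UNIV \<Otimes>\<^sub>M borel)) \<longrightarrow>
        emeasure \<Omega> {\<omega> \<in> space \<Omega>. y \<omega> \<in> A \<and> (\<forall>k<n. x \<omega> k \<in> B k)} =
        (\<integral>\<^sup>+v\<in>A. (\<Prod>k<n. emeasure (unif_circles v) (B k)) \<partial>p))"

definition iid_unif_circle :: "'a measure \<Rightarrow> 'i set \<Rightarrow> ('i \<Rightarrow> 'a \<Rightarrow> complex) \<Rightarrow> bool" where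
  "iid_unif_circle \<Omega> I u \<longleftrightarrow>
     prob_space.indep_vars \<Omega> (\<lambda>_. borel) u I \<and> (\<forall>i\<in>I. distr \<Omega> borel (u i) = unif_circle)"

definition indep_elements ::
  "'a measure \<Rightarrow> 'b measure \<Rightarrow> ('a \<Rightarrow> 'b) \<Rightarrow> 'c measure \<Rightarrow> ('a \<Rightarrow> 'c) \<Rightarrow> bool" where
  "indep_elements \<Omega> S X T Y \<longleftrightarrow>
     X \<in> measurable \<Omega> S \<and> Y \<in> measurable \<Omega> T \<and>
     prob_space.indep_set \<Omega> (sets (vimage_algebra (space \<Omega>) X S)) (sets (vimage_algebra (space \<Omega>) Y T))"

definition prob_extension :: "'b measure \<Rightarrow> 'a measure \<Rightarrow> ('b \<Rightarrow> 'a) \<Rightarrow> bool" where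
  "prob_extension N \<Omega> \<pi> \<longleftrightarrow> prob_space N \<and> \<pi> \<in> measurable N \<Omega> \<and> distr N \<Omega> \<pi> = \<Omega>"


subsection \<open>Modified permutation matrices\<close>

definition modified_perm_mat_of :: "nat \<Rightarrow> (nat \<Rightarrow> nat) \<Rightarrow> complex mat \<Rightarrow> bool" where
  "modified_perm_mat_of n \<tau> A \<longleftrightarrow>
     \<tau> permutes {..<n} \<and> A \<in> carrier_mat n n \<and>
     (\<forall>i<n. \<forall>j<n. if i = \<tau> j then cmod (A $$ (i, j)) = 1 else A $$ (i, j) = 0)"

definition modified_perm_mats :: "nat \<Rightarrow> complex mat set" where
  "modified_perm_mats n = {A. (\<exists>\<tau>. modified_perm_mat_of n \<tau> A) \<and> \<not> eigenvalue A 1}"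

definition modified_virtual_perm :: "(nat \<Rightarrow> complex mat) \<Rightarrow> bool" where
  "modified_virtual_perm M \<longleftrightarrow>
     (\<forall>n\<ge>1. M n \<in> modified_perm_mats n \<and>
        vec_space.rank (n + 1)
          (M (n + 1) - four_block_mat (M n) (0\<^sub>m n 1) (0\<^sub>m 1 n) (1\<^sub>m 1)) = 1)"

definition random_mat :: "'a measure \<Rightarrow> nat \<Rightarrow> ('a \<Rightarrow> complex mat) \<Rightarrow> bool" where
  "random_mat N n A \<longleftrightarrow>
     (\<forall>\<omega>\<in>space N. A \<omega> \<in> carrier_mat n n) \<and>
     (\<forall>i<n. \<forall>j<n. (\<lambda>\<omega>. A \<omega> $$ (i, j)) \<in> borel_measurable N)"

end

theory Submission
  imports Defs
begin

text \<open>
  Choose phases \<open>v 0, v 1, \<dots>\<close>, one for each sample point, independent, uniform on the unit circle and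
  independent of everything else. Give the edge from \<open>k\<close> to its successor \<open>\<sigma> k\<close> the phase
  \<open>v (\<sigma> k) / v k\<close>, multiplied by \<open>u j\<close> if on its circle \<open>j\<close> this edge runs through the origin. These
  edge phases are the non-zero entries of the matrices.

  The factors \<open>v (\<sigma> k) / v k\<close> telescope along a cycle, and exactly one edge of each cycle runs through
  the origin, so the product over cycle \<open>j\<close> is \<open>u j\<close> (\<open>prod_edge_phase\<close>). Since almost surely
  \<open>u j \<noteq> 1\<close>, the value 1 is not an eigenvalue (\<open>phase_mat_no_eigenvalue_1\<close>). When the
  last point \<open>n\<close> is removed, either it was alone on circle \<open>j\<close>, and only a diagonal entry changes, from
  \<open>u j \<noteq> 1\<close> to 1; or the edges into and out of \<open>n\<close> are merged into one edge, whose phase is the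
  product of their phases. That product relation is what makes the difference of the two matrices an
  outer product (\<open>rank_phase_mat_diff\<close>).

  It remains to see that the \<open>n\<close> edge phases are i.i.d. uniform. With the sample points fixed, any
  rotation of the edge phases is induced by some rotation of the phases \<open>u j\<close> and \<open>v k\<close>, namely by
  partial products along the circles (\<open>edge_phase_rotation\<close>). The law of \<open>u\<close> and \<open>v\<close> is
  invariant under rotations, hence so is the law of the edge phases, and a rotation invariant law on a
  torus is the uniform one (\<open>emeasure_rotation_invariant\<close>). This law does not depend on the sample,
  as long as its points are pairwise distinct and avoid the origins, which holds almost surely
  (\<open>AE_generic_sample\<close>); integrating over the sample gives the claim (\<open>emeasure_edge_phase\<close>).
\<close>

section \<open>Successors on the circles\<close>

lemma circle_perm_arg_min:
  assumes "k < n"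
  shows circle_perm_less: "circle_perm y x n k < n"
    and fst_circle_perm: "fst (x (circle_perm y x n k)) = fst (x k)"
    and circle_perm_le: "\<And>i. i < n \<Longrightarrow> fst (x i) = fst (x k) \<Longrightarrow>
      ccw_dist (y (fst (x k))) (snd (x k)) (snd (x (circle_perm y x n k)))
        \<le> ccw_dist (y (fst (x k))) (snd (x k)) (snd (x i))"
proof -
  define d where "d i = ccw_dist (y (fst (x k))) (snd (x k)) (snd (x i))" for i
  define P where "P i \<longleftrightarrow> i < n \<and> fst (x i) = fst (x k)" for i
  have fin: "finite {i. P i}" and ne: "{i. P i} \<noteq> {}"
    using assms by (auto simp: P_def)
  have "\<exists>i. is_arg_min d P i"
    using ex_is_arg_min_if_finite[OF fin ne, of d] by (simp add: is_arg_min_def)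
  then have "is_arg_min d P (arg_min d P)"
    unfolding arg_min_def by (rule someI_ex)
  then have *: "is_arg_min d P (circle_perm y x n k)"
    using assms by (simp add: circle_perm_def d_def[abs_def] P_def[abs_def])
  then show "circle_perm y x n k < n" "fst (x (circle_perm y x n k)) = fst (x k)"
    by (auto simp: is_arg_min_def P_def)
  fix i assume "i < n" "fst (x i) = fst (x k)"
  then have "\<not> d i < d (circle_perm y x n k)"
    using * by (auto simp: is_arg_min_def P_def)
  then show "d (circle_perm y x n k) \<le> d i" by simp
qed

text \<open>Almost every sample satisfies the following conditions. Positions are required to lie in \<open>(0, L]\<close>,
  not in \<open>[0, L)\<close>, because an upper bound that is not strict can be checked against the rational
  numbers; what matters is that the two ends of the parameter interval, which are the same point of the
  circle, do not both occur.\<close>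

locale generic_sample =
  fixes y :: "nat \<Rightarrow> real" and x :: "nat \<Rightarrow> nat \<times> real"
  assumes position_pos: "0 < snd (x k)"
    and position_le: "snd (x k) \<le> y (fst (x k))"
    and sample_inj: "inj x"
begin

abbreviation \<sigma> :: "nat \<Rightarrow> nat \<Rightarrow> nat" where "\<sigma> \<equiv> circle_perm y x"
abbreviation circ :: "nat \<Rightarrow> nat" where "circ k \<equiv> fst (x k)"
abbreviation pos :: "nat \<Rightarrow> real" where "pos k \<equiv> snd (x k)"

lemma sample_eqI: "circ i = circ k \<Longrightarrow> pos i = pos k \<Longrightarrow> i = k"
  using sample_inj by (metis injD prod_eqI)

text \<open>Either \<open>k\<close> has a point ahead of it in its circle's interval, and its successor is the nearest such
  point; or \<open>k\<close> is the last point, and the step to its successor, the first point, wraps around past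
  the origin. The inequality \<open>pos (\<sigma> n k) \<le> pos k\<close> expresses that the step wraps.\<close>

lemma succ_ahead:
  assumes "k < n" "i < n" "circ i = circ k" "pos k < pos i"
  shows "pos k < pos (\<sigma> n k)" "pos (\<sigma> n k) \<le> pos i"
  using circle_perm_le[OF assms(1), of i x y] assms position_pos[of "\<sigma> n k"]
    position_le[of i]
  by (auto simp: ccw_dist_def split: if_splits)

lemma succ_wrap:
  assumes "k < n" "\<And>i. i < n \<Longrightarrow> circ i = circ k \<Longrightarrow> pos i \<le> pos k"
    "i < n" "circ i = circ k"
  shows "pos (\<sigma> n k) \<le> pos i"
proof -
  have "pos (\<sigma> n k) \<le> pos k"
    using circle_perm_less[OF assms(1), of y x] fst_circle_perm[OF assms(1), of x y] assms(2) by blast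
  then show ?thesis
    using circle_perm_le[OF assms(1,3,4), of y] assms(2)[OF assms(3,4)]
    by (auto simp: ccw_dist_def split: if_splits)
qed

lemma succ_cases:
  assumes "k < n"
  obtains
    (ahead) "pos k < pos (\<sigma> n k)"
      "\<And>i. i < n \<Longrightarrow> circ i = circ k \<Longrightarrow> pos k < pos i \<Longrightarrow> pos (\<sigma> n k) \<le> pos i"
  | (wrap) "pos (\<sigma> n k) \<le> pos k"
      "\<And>i. i < n \<Longrightarrow> circ i = circ k \<Longrightarrow> pos i \<le> pos k"
      "\<And>i. i < n \<Longrightarrow> circ i = circ k \<Longrightarrow> pos (\<sigma> n k) \<le> pos i"
proof (cases "\<exists>i<n. circ i = circ k \<and> pos k < pos i")
  case True
  then show ?thesis using succ_ahead[OF assms] ahead by blast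
next
  case False
  then have last: "\<And>i. i < n \<Longrightarrow> circ i = circ k \<Longrightarrow> pos i \<le> pos k" by force
  show ?thesis
    by (rule wrap) (use succ_wrap[OF assms last] last assms in auto)
qed

lemma succ_eqI_ahead:
  assumes "k < n" "i < n" "circ i = circ k" "pos k < pos i"
    "\<And>l. l < n \<Longrightarrow> circ l = circ k \<Longrightarrow> pos k < pos l \<Longrightarrow> pos i \<le> pos l"
  shows "\<sigma> n k = i"
  using succ_ahead[OF assms(1-4)] assms(5)[of "\<sigma> n k"] circle_perm_less[OF assms(1), of y x]
    fst_circle_perm[OF assms(1), of x y] assms(3) by - (rule sample_eqI; auto)

lemma succ_eqI_wrap:
  assumes "k < n" "i < n" "circ i = circ k"
    "\<And>l. l < n \<Longrightarrow> circ l = circ k \<Longrightarrow> pos l \<le> pos k"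
    "\<And>l. l < n \<Longrightarrow> circ l = circ k \<Longrightarrow> pos i \<le> pos l"
  shows "\<sigma> n k = i"
  using succ_wrap[OF assms(1,4,2,3)] assms(5)[of "\<sigma> n k"] circle_perm_less[OF assms(1), of y x]
    fst_circle_perm[OF assms(1), of x y] assms(3) by - (rule sample_eqI; auto)

text \<open>Two points with the same successor are at the same position: if both steps go ahead, the point
  behind would meet the other one first; if both wrap, both points are last; and the mixed case would
  put the common successor strictly ahead of a point and yet at the first position.\<close>

lemma circle_perm_permutes: "\<sigma> n permutes {..<n}"
proof -
  have "k = k'" if "k < n" "k' < n" "\<sigma> n k = \<sigma> n k'" for k k'
  proof -
    have c: "circ k' = circ k" using that fst_circle_perm by metis
    have ge: "pos k \<le> pos k'" if h: "k < n" "k' < n" "\<sigma> n k = \<sigma> n k'" "circ k' = circ k" for k k'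
      using h(1)
    proof (cases rule: succ_cases)
      case ahead
      with h show ?thesis using succ_ahead[of k' n k] by (metis leD not_le_imp_less)
    next
      case wrap
      note w = this
      show ?thesis using h(2)
      proof (cases rule: succ_cases)
        case ahead
        then show ?thesis using w(3)[of k'] h by auto
      next
        case wrap
        then show ?thesis using h by auto
      qed
    qed
    have "pos k = pos k'"
      using ge[OF that c] ge[OF that(2,1) that(3)[symmetric] c[symmetric]] by simp
    then show ?thesis using c by - (rule sample_eqI; auto)
  qed
  then have "inj_on (\<sigma> n) {..<n}" by (auto simp: inj_on_def)
  moreover have "\<sigma> n ` {..<n} \<subseteq> {..<n}" using circle_perm_less by auto
  ultimately have "bij_betw (\<sigma> n) {..<n} {..<n}"
    by (simp add: bij_betw_def endo_inj_surj)
  then show ?thesis by (rule bij_imp_permutes) (simp add: circle_perm_def)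
qed

lemma circle_perm_bij_cycle_supp: "bij_betw (\<sigma> n) (cycle_supp x n j) (cycle_supp x n j)"
proof -
  have "inj_on (\<sigma> n) (cycle_supp x n j)"
    using circle_perm_permutes[of n] by (metis permutes_inj inj_on_subset subset_UNIV)
  moreover have "\<sigma> n ` cycle_supp x n j \<subseteq> cycle_supp x n j"
    using circle_perm_less fst_circle_perm by (auto simp: cycle_supp_def)
  moreover have "finite (cycle_supp x n j)" by (simp add: cycle_supp_def)
  ultimately show ?thesis by (simp add: bij_betw_def endo_inj_surj)
qed

lemma wrap_unique:
  assumes "k < n" "k' < n" "circ k = circ k'"
    "pos (\<sigma> n k) \<le> pos k" "pos (\<sigma> n k') \<le> pos k'"
  shows "k = k'"
proof -
  have le: "pos k \<le> pos k'"
    if "k < n" "k' < n" "circ k = circ k'" "pos (\<sigma> n k') \<le> pos k'" for k k'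
    using that(2)
  proof (cases rule: succ_cases)
    case ahead
    with that show ?thesis by simp
  next
    case wrap
    then show ?thesis using that by simp
  qed
  have "pos k = pos k'"
    using le[OF assms(1,2,3,5)] le[OF assms(2,1) assms(3)[symmetric] assms(4)] by simp
  then show ?thesis using assms(3) by - (rule sample_eqI; auto)
qed

text \<open>A point of the invariant set at the greatest position cannot have its successor ahead of it.\<close>

lemma ex_wrap_invariant:
  assumes "T \<subseteq> {..<n}" "T \<noteq> {}" "\<And>k. k \<in> T \<Longrightarrow> \<sigma> n k \<in> T"
  shows "\<exists>k\<in>T. pos (\<sigma> n k) \<le> pos k"
proof -
  have fin: "finite T" using assms(1) finite_subset by blast
  have "Max (pos ` T) \<in> pos ` T"
    using fin assms(2) by (intro Max_in) auto
  then obtain m where m: "m \<in> T" "Max (pos ` T) = pos m"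
    by blast
  have "pos (\<sigma> n m) \<le> pos m"
    unfolding m(2)[symmetric] using fin assms(3)[OF m(1)] by (intro Max_ge) auto
  then show ?thesis using m(1) by blast
qed

lemma ex1_wrap:
  assumes "cycle_supp x n j \<noteq> {}"
  shows "\<exists>!k. k \<in> cycle_supp x n j \<and> pos (\<sigma> n k) \<le> pos k"
proof -
  have "\<exists>k\<in>cycle_supp x n j. pos (\<sigma> n k) \<le> pos k"
    using assms bij_betwE[OF circle_perm_bij_cycle_supp[of n j]]
    by (intro ex_wrap_invariant) (auto simp: cycle_supp_def)
  then show ?thesis by (auto simp: cycle_supp_def intro: wrap_unique)
qed

text \<open>A proper invariant part of the points of a circle and its complement, which is invariant too, would
  both contain a wrapping step, but there is only one. Hence the points of a circle form one cycle.\<close>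

lemma cycle_supp_transitive:
  assumes "T \<subseteq> cycle_supp x n j" "T \<noteq> {}" "\<And>k. k \<in> T \<Longrightarrow> \<sigma> n k \<in> T"
  shows "T = cycle_supp x n j"
proof (rule ccontr)
  let ?S = "cycle_supp x n j"
  assume "T \<noteq> ?S"
  then have ne: "?S - T \<noteq> {}" using assms(1) by blast
  have S: "?S \<subseteq> {..<n}" by (auto simp: cycle_supp_def)
  have inj: "inj (\<sigma> n)" using circle_perm_permutes[of n] by (rule permutes_inj)
  have "finite T" using assms(1) by (rule finite_subset) (simp add: cycle_supp_def)
  then have img: "\<sigma> n ` T = T"
    using assms(3) inj by (intro endo_inj_surj) (auto intro: inj_on_subset)
  have inv: "\<sigma> n k \<in> ?S - T" if k: "k \<in> ?S - T" for k
  proof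
    show "\<sigma> n k \<in> ?S"
      using bij_betwE[OF circle_perm_bij_cycle_supp[of n j]] k by blast
    show "\<sigma> n k \<notin> T"
      using k img inj by (metis DiffD2 imageE injD)
  qed
  obtain a where a: "a \<in> T" "pos (\<sigma> n a) \<le> pos a"
    using ex_wrap_invariant[of T n] assms S by blast
  obtain b where b: "b \<in> ?S - T" "pos (\<sigma> n b) \<le> pos b"
    using ex_wrap_invariant[of "?S - T" n] inv ne S by blast
  have "a = b" using a b assms(1) by (intro wrap_unique[of a n b]) (auto simp: cycle_supp_def)
  then show False using a b by simp
qed

lemma circle_perm_Suc_new_fixed:
  assumes "\<sigma> (Suc n) n = n" "k < n"
  shows "circ k \<noteq> circ n"
proof
  assume c: "circ k = circ n"
  then have "pos k \<noteq> pos n" using sample_eqI[of k n] assms by auto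
  then show False
    using succ_ahead[of n "Suc n" k] succ_wrap[of n "Suc n" k] assms c
    by (smt (verit) less_Suc_eq lessI order.strict_trans succ_cases)
qed

text \<open>The next two lemmas say that \<open>\<sigma> n\<close> is \<open>\<sigma> (Suc n)\<close> with the point \<open>n\<close> bypassed. The step that
  replaces the two steps through \<open>n\<close> wraps if one of these wraps, and they cannot both wrap.\<close>

lemma circle_perm_Suc_old:
  assumes "k < n" "\<sigma> (Suc n) k \<noteq> n"
  shows "\<sigma> n k = \<sigma> (Suc n) k"
proof -
  let ?i = "\<sigma> (Suc n) k"
  have k: "k < Suc n" using assms by simp
  have i: "?i < n" "circ ?i = circ k"
    using circle_perm_less[OF k, of y x] fst_circle_perm[OF k, of x y] assms by auto
  show ?thesis using k
  proof (cases rule: succ_cases)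
    case ahead
    then show ?thesis using assms i by (intro succ_eqI_ahead) auto
  next
    case wrap
    then show ?thesis using assms i by (intro succ_eqI_wrap) auto
  qed
qed

lemma circle_perm_Suc_pred:
  assumes "a < n" "\<sigma> (Suc n) a = n"
  shows "\<sigma> (Suc n) n < n" "\<sigma> n a = \<sigma> (Suc n) n"
    "pos (\<sigma> (Suc n) n) \<le> pos a \<longleftrightarrow> pos n \<le> pos a \<or> pos (\<sigma> (Suc n) n) \<le> pos n"
    "\<not> (pos n \<le> pos a \<and> pos (\<sigma> (Suc n) n) \<le> pos n)"
proof -
  let ?b = "\<sigma> (Suc n) n"
  have a: "a < Suc n" and n: "n < Suc n" using assms by auto
  have c: "circ n = circ a" using fst_circle_perm[OF a, of x y] assms by simp
  have b: "?b < Suc n" "circ ?b = circ n"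
    using circle_perm_less[OF n, of y x] fst_circle_perm[OF n, of x y] by auto
  have ne: "pos n \<noteq> pos a" using sample_eqI[of n a] c assms by auto
  show bn: "?b < n"
    using circle_perm_Suc_new_fixed[OF _ assms(1)] c b(1) by (metis less_SucE)
  have eq: "pos l = pos k \<Longrightarrow> circ l = circ k \<Longrightarrow> l = k" for l k by (rule sample_eqI)
  have "\<sigma> n a = ?b \<and> (pos ?b \<le> pos a \<longleftrightarrow> pos n \<le> pos a \<or> pos ?b \<le> pos n)
    \<and> \<not> (pos n \<le> pos a \<and> pos ?b \<le> pos n)"
    using a
  proof (cases rule: succ_cases)
    case ahead
    note A = this[unfolded assms(2)]
    show ?thesis using n
    proof (cases rule: succ_cases)
      case ahead
      have "pos n \<le> pos l" if "l < n" "circ l = circ a" "pos a < pos l" for l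
        using A(2)[of l] that by simp
      moreover have "pos n \<noteq> pos l" if "l < n" "circ l = circ a" for l
        using eq[of n l] that c by auto
      ultimately have "\<sigma> n a = ?b"
        using ahead b bn c A assms
        by (intro succ_eqI_ahead) (auto simp: less_le)
      then show ?thesis using ahead A by auto
    next
      case wrap
      have le: "pos l \<le> pos a" if "l < n" "circ l = circ a" for l
      proof (rule ccontr)
        assume "\<not> pos l \<le> pos a"
        then have "pos n \<le> pos l" using A(2)[of l] that by simp
        moreover have "pos l \<le> pos n" using wrap(2)[of l] that c by simp
        ultimately show False using eq[of n l] that c by auto
      qed
      have "\<sigma> n a = ?b"
        using le wrap b bn c A assms by (intro succ_eqI_wrap) auto
      then show ?thesis using wrap A le[of ?b] bn b c by auto
    qed
  next
    case wrap
    note A = this[unfolded assms(2)]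
    have "pos n < pos ?b"
      using A(3)[of ?b] b c eq[of n ?b] bn by (auto simp: less_le)
    show ?thesis using n
    proof (cases rule: succ_cases)
      case ahead
      have "pos ?b \<le> pos l" if "l < n" "circ l = circ a" for l
        using A(3)[of l] ahead(2)[of l] eq[of n l] that c by (auto simp: less_le)
      then have "\<sigma> n a = ?b"
        using A b bn c assms by (intro succ_eqI_wrap) auto
      then show ?thesis using ahead A b c by auto
    next
      case wrap
      then have "pos ?b \<le> pos n" by blast
      then show ?thesis using \<open>pos n < pos ?b\<close> by simp
    qed
  qed
  then show "\<sigma> n a = ?b" "pos ?b \<le> pos a \<longleftrightarrow> pos n \<le> pos a \<or> pos ?b \<le> pos n"
    "\<not> (pos n \<le> pos a \<and> pos ?b \<le> pos n)" by auto
qed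

end

section \<open>Matrices built from phases\<close>

lemma rank_outer_product:
  fixes f g :: "nat \<Rightarrow> complex"
  assumes "i < n" "j < m" "f i \<noteq> 0" "g j \<noteq> 0"
  shows "vec_space.rank n (mat n m (\<lambda>(r, c). f r * g c)) = 1"
proof -
  interpret vec_space "TYPE(complex)" n .
  let ?A = "mat n m (\<lambda>(r, c). f r * g c)"
  have "rank ?A \<le> 1"
    by (rule rank_le_1_product_entries) auto
  moreover have "1 \<le> rank ?A"
  proof -
    have "col ?A j \<in> set (cols ?A)"
      using assms(2) by (auto simp: cols_def)
    moreover have "col ?A j \<noteq> 0\<^sub>v n"
    proof
      assume "col ?A j = 0\<^sub>v n"
      then have "vec_index (col ?A j) i = 0" using assms by simp
      then show False using assms by simp
    qed
    moreover have "col ?A j \<in> carrier_vec n" by (simp add: carrier_vecI)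
    ultimately have "lin_indpt {col ?A j}" "{col ?A j} \<subseteq> set (cols ?A)"
      using lindep_span[of "{col ?A j}"] span_empty by auto
    then show ?thesis
      using rank_ge_card_indpt[of ?A m "{col ?A j}"] by simp
  qed
  ultimately show ?thesis by simp
qed

text \<open>The quotient \<open>v (\<sigma> k) / v k\<close> has no effect on the product over a cycle, but randomises the
  individual entries. The factor \<open>u j\<close> sits on the edge through the origin, rather than at
  a chosen point, because that edge survives as an edge through the origin when points are removed.\<close>

definition edge_phase ::
  "(nat \<Rightarrow> real) \<Rightarrow> (nat \<Rightarrow> nat \<times> real) \<Rightarrow> (nat \<Rightarrow> complex) \<Rightarrow> (nat \<Rightarrow> complex) \<Rightarrow> nat \<Rightarrow> nat \<Rightarrow> complex"
where
  "edge_phase y x u v n k =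
     v (circle_perm y x n k) / v k *
     (if snd (x (circle_perm y x n k)) \<le> snd (x k) then u (fst (x k)) else 1)"

definition phase_mat ::
  "(nat \<Rightarrow> real) \<Rightarrow> (nat \<Rightarrow> nat \<times> real) \<Rightarrow> (nat \<Rightarrow> complex) \<Rightarrow> (nat \<Rightarrow> complex) \<Rightarrow> nat \<Rightarrow> complex mat"
where
  "phase_mat y x u v n =
     mat n n (\<lambda>(i, k). if i = circle_perm y x n k then edge_phase y x u v n k else 0)"

lemma phase_mat_carrier [simp]: "phase_mat y x u v n \<in> carrier_mat n n"
  by (simp add: phase_mat_def)

lemma phase_mat_dims [simp]:
  "dim_row (phase_mat y x u v n) = n" "dim_col (phase_mat y x u v n) = n"
  by (simp_all add: phase_mat_def)

lemma phase_mat_index [simp]: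
  "i < n \<Longrightarrow> k < n \<Longrightarrow> phase_mat y x u v n $$ (i, k) =
     (if i = circle_perm y x n k then edge_phase y x u v n k else 0)"
  by (simp add: phase_mat_def)

lemma phase_mat_circle_perm:
  "k < n \<Longrightarrow> phase_mat y x u v n $$ (circle_perm y x n k, k) = edge_phase y x u v n k"
  using circle_perm_less[of k n y x] by simp

locale generic_phases = generic_sample +
  fixes u v :: "nat \<Rightarrow> complex"
  assumes norm_u: "cmod (u j) = 1" and norm_v: "cmod (v k) = 1" and u_neq_1: "u j \<noteq> 1"
begin

abbreviation z :: "nat \<Rightarrow> nat \<Rightarrow> complex" where "z \<equiv> edge_phase y x u v"
abbreviation M :: "nat \<Rightarrow> complex mat" where "M \<equiv> phase_mat y x u v"

lemma v_nonzero [simp]: "v k \<noteq> 0"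
  using norm_v[of k] by auto

lemma norm_edge_phase: "cmod (z n k) = 1"
  by (simp add: edge_phase_def norm_mult norm_divide norm_u norm_v)

lemma modified_perm_phase_mat: "modified_perm_mat_of n (\<sigma> n) (M n)"
  using circle_perm_permutes by (auto simp: modified_perm_mat_of_def norm_edge_phase)

lemma prod_edge_phase:
  assumes "cycle_supp x n j \<noteq> {}"
  shows "(\<Prod>k\<in>cycle_supp x n j. z n k) = u j"
proof -
  let ?S = "cycle_supp x n j"
  have fin: "finite ?S" by (simp add: cycle_supp_def)
  obtain m where m: "m \<in> ?S" "pos (\<sigma> n m) \<le> pos m"
    and uniq: "\<And>k. k \<in> ?S \<Longrightarrow> pos (\<sigma> n k) \<le> pos k \<Longrightarrow> k = m"
    using ex1_wrap[OF assms] by blast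
  have z: "z n k = v (\<sigma> n k) / v k * (if k = m then u j else 1)" if k: "k \<in> ?S" for k
  proof -
    have "pos (\<sigma> n k) \<le> pos k \<longleftrightarrow> k = m" using m(2) uniq[OF k] by blast
    moreover have "circ k = j" using k by (simp add: cycle_supp_def)
    ultimately show ?thesis by (auto simp: edge_phase_def)
  qed
  have "(\<Prod>k\<in>?S. z n k) = (\<Prod>k\<in>?S. v (\<sigma> n k) / v k * (if k = m then u j else 1))"
    by (rule prod.cong[OF refl]) (rule z)
  also have "\<dots> = (\<Prod>k\<in>?S. v (\<sigma> n k)) / (\<Prod>k\<in>?S. v k) * (\<Prod>k\<in>?S. if k = m then u j else 1)"
    by (simp only: prod.distrib prod_dividef)
  also have "(\<Prod>k\<in>?S. v (\<sigma> n k)) = (\<Prod>k\<in>?S. v k)"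
    by (rule prod.reindex_bij_betw[OF circle_perm_bij_cycle_supp])
  also have "(\<Prod>k\<in>?S. if k = m then u j else 1) = u j"
    using fin m(1) by (simp add: prod.delta)
  finally show ?thesis using fin by simp
qed

text \<open>A fixed vector \<open>g\<close> satisfies \<open>g (\<sigma> k) = z k * g k\<close> for the edge phases \<open>z\<close>. By transitivity it vanishes
  nowhere on a cycle on which it is not zero, so multiplying these equations over the cycle \<open>j\<close> and cancelling
  gives \<open>u j = 1\<close>.\<close>

lemma phase_mat_no_eigenvalue_1: "\<not> eigenvalue (M n) 1"
proof
  assume "eigenvalue (M n) 1"
  then obtain w where w: "w \<in> carrier_vec n" "w \<noteq> 0\<^sub>v n" "M n *\<^sub>v w = w"
    by (auto simp: eigenvalue_def eigenvector_def)
  define g where "g = vec_index w"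
  have step: "g (\<sigma> n k) = z n k * g k" if k: "k < n" for k
  proof -
    have s: "\<sigma> n k < n" using circle_perm_less[OF k] .
    have eq: "\<sigma> n k = \<sigma> n i \<longleftrightarrow> i = k" for i
      using permutes_inj[OF circle_perm_permutes, of n] by (auto dest: injD)
    have "g (\<sigma> n k) = vec_index (M n *\<^sub>v w) (\<sigma> n k)" using w(3) by (simp add: g_def)
    also have "\<dots> = (\<Sum>i<n. M n $$ (\<sigma> n k, i) * g i)"
      using s w(1) by (simp add: scalar_prod_def atLeast0LessThan g_def)
    also have "\<dots> = (\<Sum>i<n. if i = k then z n k * g k else 0)"
      using s by (intro sum.cong) (auto simp: eq)
    finally show ?thesis using k by simp
  qed
  obtain i where i: "i < n" "g i \<noteq> 0"
    using w(1,2) unfolding g_def by (metis carrier_vecD eq_vecI index_zero_vec)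
  let ?S = "cycle_supp x n (circ i)"
  have "{k \<in> ?S. g k \<noteq> 0} = ?S"
  proof (rule cycle_supp_transitive)
    show "{k \<in> ?S. g k \<noteq> 0} \<noteq> {}" using i by (auto simp: cycle_supp_def)
    fix k assume k: "k \<in> {k \<in> ?S. g k \<noteq> 0}"
    then have "z n k \<noteq> 0" "k < n"
      using norm_edge_phase[of n k] by (auto simp: cycle_supp_def)
    then show "\<sigma> n k \<in> {k \<in> ?S. g k \<noteq> 0}"
      using k step[of k] bij_betwE[OF circle_perm_bij_cycle_supp[of n "circ i"]] by auto
  qed blast
  then have nz: "(\<Prod>k\<in>?S. g k) \<noteq> 0"
    by (auto simp: cycle_supp_def)
  have "(\<Prod>k\<in>?S. g k) = (\<Prod>k\<in>?S. g (\<sigma> n k))"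
    using prod.reindex_bij_betw[OF circle_perm_bij_cycle_supp, of g n "circ i"] by simp
  also have "\<dots> = (\<Prod>k\<in>?S. z n k) * (\<Prod>k\<in>?S. g k)"
    unfolding prod.distrib[symmetric] by (intro prod.cong) (auto simp: step cycle_supp_def)
  also have "(\<Prod>k\<in>?S. z n k) = u (circ i)"
    using i by (intro prod_edge_phase) (auto simp: cycle_supp_def)
  finally show False using nz u_neq_1[of "circ i"] by simp
qed

lemma edge_phase_Suc_old:
  assumes "k < n" "\<sigma> (Suc n) k \<noteq> n"
  shows "z n k = z (Suc n) k"
  using circle_perm_Suc_old[OF assms] by (simp add: edge_phase_def)

lemma edge_phase_Suc_pred:
  assumes "a < n" "\<sigma> (Suc n) a = n"
  shows "z n a = z (Suc n) a * z (Suc n) n"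
proof -
  have "circ n = circ a" using fst_circle_perm[of a "Suc n" x y] assms by simp
  then show ?thesis
    using circle_perm_Suc_pred[OF assms] assms(2) by (auto simp: edge_phase_def)
qed

text \<open>In the case where \<open>n\<close> has a predecessor \<open>a\<close> and a successor \<open>b\<close>, the difference is supported on the
  rows \<open>n\<close> and \<open>b\<close> and the columns \<open>a\<close> and \<open>n\<close>, with entries \<open>z a, -1\<close> in row \<open>n\<close> and
  \<open>- z a * z n, z n\<close> in row \<open>b\<close>, where \<open>z\<close> denotes the edge phases of size \<open>n + 1\<close>.\<close>

lemma rank_phase_mat_diff:
  "vec_space.rank (n + 1)
     (M (n + 1) - four_block_mat (M n) (0\<^sub>m n 1) (0\<^sub>m 1 n) (1\<^sub>m 1)) = 1"
proof -
  let ?s = "\<sigma> (Suc n)"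
  let ?D = "M (n + 1) - four_block_mat (M n) (0\<^sub>m n 1) (0\<^sub>m 1 n) (1\<^sub>m 1)"
  have inj: "inj ?s" using circle_perm_permutes by (rule permutes_inj)
  have n: "n < Suc n" by simp
  have D: "?D $$ (r, c) = (if r = ?s c then z (Suc n) c else 0) -
      (if c < n then if r < n \<and> r = \<sigma> n c then z n c else 0 else if r = n then 1 else 0)"
    if "r < Suc n" "c < Suc n" for r c
    using that by auto
  show ?thesis
  proof (cases "?s n = n")
    case True
    have other: "?s c \<noteq> n" if "c < n" for c
      using that inj True by (metis injD less_irrefl)
    have "?D = mat (n + 1) (n + 1)
        (\<lambda>(r, c). (if r = n then 1 else 0) * (if c = n then u (circ n) - 1 else 0))"
      (is "_ = ?R")
    proof (rule eq_matI)
      fix r c assume "r < dim_row ?R" "c < dim_col ?R"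
      then have rc: "r < Suc n" "c < Suc n" by auto
      have "z (Suc n) n = u (circ n)" using True by (simp add: edge_phase_def)
      then show "?D $$ (r, c) = ?R $$ (r, c)"
        using D[OF rc] rc True other[of c] circle_perm_Suc_old[of c n] edge_phase_Suc_old[of c n]
          circle_perm_less[of c n y x]
        by (cases "c = n") auto
    qed auto
    then show ?thesis
      using u_neq_1[of "circ n"]
      by (simp only:) (rule rank_outer_product[of n _ n], auto)
  next
    case False
    have "n \<in> ?s ` {..<Suc n}"
      using permutes_image[OF circle_perm_permutes[of "Suc n"]] by simp
    with False obtain a where a: "a < n" "?s a = n"
      by (metis imageE lessThan_iff less_SucE)
    note pred = circle_perm_Suc_pred[OF a]
    let ?b = "?s n"
    have other: "?s c \<noteq> n" if "c \<noteq> a" for c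
      using that inj a by (metis injD)
    have "?D = mat (n + 1) (n + 1)
        (\<lambda>(r, c). (if r = n then 1 else if r = ?b then - z (Suc n) n else 0) *
          (if c = a then z (Suc n) a else if c = n then - 1 else 0))"
      (is "_ = ?R")
    proof (rule eq_matI)
      fix r c assume "r < dim_row ?R" "c < dim_col ?R"
      then have rc: "r < Suc n" "c < Suc n" by auto
      show "?D $$ (r, c) = ?R $$ (r, c)"
        using D[OF rc] rc a pred(1,2) other[of c] circle_perm_Suc_old[of c n]
          edge_phase_Suc_old[of c n] edge_phase_Suc_pred[OF a] circle_perm_less[of c n y x]
        by (cases "c = n"; cases "c = a") auto
    qed auto
    then show ?thesis
      using False a norm_edge_phase[of "Suc n" a]
      by (simp only:) (rule rank_outer_product[of n _ a], auto)
  qed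
qed

lemma modified_virtual_perm_phase_mat: "modified_virtual_perm M"
  unfolding modified_virtual_perm_def modified_perm_mats_def
  using modified_perm_phase_mat phase_mat_no_eigenvalue_1 rank_phase_mat_diff by blast

end

section \<open>The uniform distribution on the circle\<close>

lemma borel_measurable_cis: "cis \<in> borel_measurable borel"
  by (intro borel_measurable_continuous_onI continuous_on_cis continuous_on_id)

lemma measurable_cis_uniform_measure: "cis \<in> borel_measurable (uniform_measure lborel A)"
proof -
  have "sets (uniform_measure lborel A) = sets borel" by simp
  then show ?thesis using borel_measurable_cis measurable_cong_sets by blast
qed

lemma emeasure_unif_circle:
  assumes "A \<in> sets borel"
  shows "emeasure unif_circle A = emeasure lborel ({0..<2 * pi} \<inter> cis -` A) / ennreal (2 * pi)"
proof -
  have "cis -` A \<in> sets lborel"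
    using measurable_sets[OF borel_measurable_cis assms] by simp
  then show ?thesis
    unfolding unif_circle_def using assms measurable_cis_uniform_measure
    by (subst emeasure_distr) auto
qed

lemma sets_unif_circle [simp, measurable_cong]: "sets unif_circle = sets borel"
  by (simp add: unif_circle_def)

lemma space_unif_circle [simp]: "space unif_circle = UNIV"
  by (simp add: unif_circle_def)

lemma prob_space_unif_circle: "prob_space unif_circle"
  unfolding unif_circle_def
  by (intro prob_space.prob_space_distr prob_space_uniform_measure)
    (auto simp: measurable_cis_uniform_measure)

lemma AE_unif_circle_norm: "AE w in unif_circle. cmod w = 1"
  unfolding unif_circle_def
  by (subst AE_distr_iff) (auto simp: measurable_cis_uniform_measure)

lemma AE_unif_circle_neq_1: "AE w in unif_circle. w \<noteq> 1"
proof -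
  have "{0..<2 * pi} \<inter> cis -` {1} = {0}"
  proof (intro equalityI subsetI)
    fix t assume t: "t \<in> {0..<2 * pi} \<inter> cis -` {1}"
    then have "cos t = 1" by (auto simp: complex_eq_iff)
    then obtain k :: int where k: "t = k * 2 * pi"
      by (auto simp: cos_one_2pi_int)
    then have "0 \<le> real_of_int k" "real_of_int k < 1"
      using t pi_gt_zero by (auto simp: zero_le_mult_iff)
    then have "k = 0" by linarith
    then show "t \<in> {0}" using k by simp
  qed auto
  then have "{1} \<in> null_sets unif_circle"
    by (auto simp: emeasure_unif_circle null_sets_def)
  then show ?thesis
    by (rule AE_I'[of "{1}"]) auto
qed

text \<open>Rotating by an angle \<open>a\<close> translates the parameter interval to \<open>[a, 2\<pi> + a)\<close>, whose part beyond
  \<open>2\<pi>\<close> is carried back to \<open>[0, a)\<close> by periodicity.\<close>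

lemma emeasure_unif_circle_rotate:
  assumes "cmod c = 1" and A: "A \<in> sets borel"
  shows "emeasure unif_circle {w. c * w \<in> A} = emeasure unif_circle A"
proof -
  obtain a where a: "0 \<le> a" "a < 2 * pi" and c: "c = cis a"
    using assms Arg2pi[of c] by (metis Arg2pi_eq cis_conv_exp mult_1 of_real_1)
  let ?P = "cis -` A"
  have P: "?P \<in> sets lborel"
    using measurable_sets[OF borel_measurable_cis A] by simp
  have shift: "emeasure lborel {t. t + b \<in> S} = emeasure lborel S" if "S \<in> sets borel"
    for S and b :: real
  proof -
    have "emeasure lborel S = emeasure (distr lborel borel ((+) b)) S"
      by (simp add: lborel_distr_plus)
    also have "\<dots> = emeasure lborel {t. t + b \<in> S}"
      using that by (subst emeasure_distr) (auto simp: vimage_def add.commute)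
    finally show ?thesis ..
  qed
  have "{w. c * w \<in> A} \<in> sets borel"
    using measurable_sets[of "\<lambda>w. c * w" borel borel A] A by (simp add: vimage_def)
  then have "emeasure unif_circle {w. c * w \<in> A} =
      emeasure lborel ({0..<2 * pi} \<inter> cis -` {w. c * w \<in> A}) / ennreal (2 * pi)"
    by (rule emeasure_unif_circle)
  also have "{0..<2 * pi} \<inter> cis -` {w. c * w \<in> A} = {t. t + a \<in> {a..<2 * pi + a} \<inter> ?P}"
    by (auto simp: c cis_mult add.commute)
  also have "emeasure lborel \<dots> = emeasure lborel ({a..<2 * pi + a} \<inter> ?P)"
    using P by (intro shift) auto
  also have "{a..<2 * pi + a} \<inter> ?P = ({a..<2 * pi} \<inter> ?P) \<union> ({2 * pi..<2 * pi + a} \<inter> ?P)"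
    using a by auto
  also have "emeasure lborel \<dots> =
      emeasure lborel ({a..<2 * pi} \<inter> ?P) + emeasure lborel ({2 * pi..<2 * pi + a} \<inter> ?P)"
    using P by (intro plus_emeasure[symmetric]) auto
  also have "emeasure lborel ({2 * pi..<2 * pi + a} \<inter> ?P) =
      emeasure lborel {t. t + 2 * pi \<in> {2 * pi..<2 * pi + a} \<inter> ?P}"
    using P by (intro shift[symmetric]) auto
  also have "{t. t + 2 * pi \<in> {2 * pi..<2 * pi + a} \<inter> ?P} = {0..<a} \<inter> ?P"
    by (auto simp: cis.ctr)
  also have "emeasure lborel ({a..<2 * pi} \<inter> ?P) + emeasure lborel ({0..<a} \<inter> ?P) =
      emeasure lborel (({a..<2 * pi} \<inter> ?P) \<union> ({0..<a} \<inter> ?P))"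
    using P by (intro plus_emeasure) auto
  also have "({a..<2 * pi} \<inter> ?P) \<union> ({0..<a} \<inter> ?P) = {0..<2 * pi} \<inter> ?P"
    using a by auto
  also have "emeasure lborel \<dots> / ennreal (2 * pi) = emeasure unif_circle A"
    using A by (rule emeasure_unif_circle[symmetric])
  finally show ?thesis .
qed

abbreviation phases :: "'i set \<Rightarrow> ('i \<Rightarrow> complex) measure" where
  "phases I \<equiv> \<Pi>\<^sub>M i\<in>I. unif_circle"

interpretation phases: product_prob_space "\<lambda>_::'i. unif_circle" I for I
  by (intro product_prob_spaceI prob_space_unif_circle)

lemma sets_phases: "sets (phases I) = sets (\<Pi>\<^sub>M i\<in>I. borel)"
  by (intro sets_PiM_cong) auto

lemma distr_phases_rotate:
  fixes c :: "'i \<Rightarrow> complex"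
  assumes "\<And>i. cmod (c i) = 1"
  shows "distr (phases UNIV) (phases UNIV) (\<lambda>w i. c i * w i) = phases UNIV"
proof (rule phases.PiM_eq)
  fix J :: "'i set" and F :: "'i \<Rightarrow> complex set"
  assume J: "finite J" and F: "\<And>j. j \<in> J \<Longrightarrow> F j \<in> sets unif_circle"
  have C: "{t. c j * t \<in> F j} \<in> sets borel" if "j \<in> J" for j
    using measurable_sets[of "\<lambda>t. c j * t" borel borel "F j"] F[OF that] by (simp add: vimage_def)
  have meas: "(\<lambda>w i. c i * w i) \<in> measurable (phases UNIV) (phases UNIV)"
    by (rule measurable_PiM_single') (auto simp: space_PiM)
  have S: "prod_emb UNIV (\<lambda>_. unif_circle) J (Pi\<^sub>E J F) \<in> sets (phases UNIV)"
    using J F by (intro sets_PiM_I) auto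
  have "emeasure (distr (phases UNIV) (phases UNIV) (\<lambda>w i. c i * w i))
      (prod_emb UNIV (\<lambda>_. unif_circle) J (Pi\<^sub>E J F)) =
    emeasure (phases UNIV) {w \<in> space (phases UNIV). \<forall>j\<in>J. w j \<in> {t. c j * t \<in> F j}}"
    unfolding emeasure_distr[OF meas S]
    by (rule arg_cong[where f = "emeasure (phases UNIV)"])
      (auto simp: prod_emb_def space_PiM Pi_iff)
  also have "\<dots> = (\<Prod>j\<in>J. emeasure unif_circle {t. c j * t \<in> F j})"
    using J C by (intro phases.emeasure_PiM_Collect) auto
  also have "\<dots> = (\<Prod>j\<in>J. emeasure unif_circle (F j))"
    using F assms by (intro prod.cong emeasure_unif_circle_rotate) auto
  finally show "emeasure (distr (phases UNIV) (phases UNIV) (\<lambda>w i. c i * w i))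
      (prod_emb UNIV (\<lambda>_. unif_circle) J (Pi\<^sub>E J F)) = (\<Prod>j\<in>J. emeasure unif_circle (F j))" .
qed simp

text \<open>An independent uniform rotation of the coordinates turns any vector of unit complex numbers into
  one with i.i.d. uniform coordinates. If fixed rotations do not alter the law of the vector \<open>f\<close>, then
  a random one does not either, so \<open>f\<close> itself is i.i.d. uniform. The invariance
  is expressed by lifting every rotation to a measure preserving map \<open>T\<close> of the probability space.\<close>

lemma emeasure_rotation_invariant:
  fixes f :: "'i \<Rightarrow> 'a \<Rightarrow> complex"
  assumes "prob_space P" "finite I"
    and meas: "\<And>i. i \<in> I \<Longrightarrow> f i \<in> borel_measurable P"
    and norm: "\<And>i. i \<in> I \<Longrightarrow> AE w in P. cmod (f i w) = 1"
    and rotate: "\<And>a. (\<And>i. i \<in> I \<Longrightarrow> cmod (a i) = 1) \<Longrightarrow>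
      \<exists>T \<in> measurable P P. distr P P T = P \<and> (\<forall>w\<in>space P. \<forall>i\<in>I. f i (T w) = a i * f i w)"
    and B: "\<And>i. i \<in> I \<Longrightarrow> B i \<in> sets borel"
  shows "emeasure P {w \<in> space P. \<forall>i\<in>I. f i w \<in> B i} = (\<Prod>i\<in>I. emeasure unif_circle (B i))"
proof -
  interpret P: prob_space P by fact
  interpret PA: pair_prob_space "phases I" P ..
  \<comment> \<open>The measure of this event, integrated over \<open>w\<close> first or over \<open>a\<close> first, gives the two sides.\<close>
  let ?E = "{q \<in> space (phases I \<Otimes>\<^sub>M P). \<forall>i\<in>I. fst q i * f i (snd q) \<in> B i}"
  note meas [measurable] B [measurable]
  have E: "?E \<in> sets (phases I \<Otimes>\<^sub>M P)"
  proof (rule sets.sets_Collect_finite_All[OF _ assms(2)])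
    fix i assume i: "i \<in> I"
    have "(\<lambda>q. fst q i * f i (snd q)) \<in> borel_measurable (phases I \<Otimes>\<^sub>M P)"
    proof (rule borel_measurable_times)
      show "(\<lambda>q. fst q i) \<in> borel_measurable (phases I \<Otimes>\<^sub>M P)"
        using measurable_compose[OF measurable_fst measurable_component_singleton[OF i]]
          measurable_cong_sets[OF refl sets_unif_circle] by blast
      show "(\<lambda>q. f i (snd q)) \<in> borel_measurable (phases I \<Otimes>\<^sub>M P)"
        using i by measurable
    qed
    from measurable_sets[OF this B[OF i]]
    show "{q \<in> space (phases I \<Otimes>\<^sub>M P). fst q i * f i (snd q) \<in> B i} \<in> sets (phases I \<Otimes>\<^sub>M P)"
      by (simp add: vimage_def Int_def conj_commute)
  qed
  \<comment> \<open>rotating by a fixed \<open>a\<close> does not change the law of \<open>f\<close>\<close>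
  have 1: "emeasure P {w \<in> space P. \<forall>i\<in>I. a i * f i w \<in> B i} =
      emeasure P {w \<in> space P. \<forall>i\<in>I. f i w \<in> B i}"
    if a: "\<And>i. i \<in> I \<Longrightarrow> cmod (a i) = 1" for a
  proof -
    obtain T where T: "T \<in> measurable P P" "distr P P T = P"
      "\<And>w i. w \<in> space P \<Longrightarrow> i \<in> I \<Longrightarrow> f i (T w) = a i * f i w"
      using rotate[of a] a by auto
    let ?F = "{w \<in> space P. \<forall>i\<in>I. f i w \<in> B i}"
    have F: "?F \<in> sets P" using assms(2) by measurable
    have "emeasure P ?F = emeasure (distr P P T) ?F" using T(2) by simp
    also have "\<dots> = emeasure P (T -` ?F \<inter> space P)"
      using T(1) F by (rule emeasure_distr)
    also have "T -` ?F \<inter> space P = {w \<in> space P. \<forall>i\<in>I. a i * f i w \<in> B i}"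
      using T(3) measurable_space[OF T(1)] by auto
    finally show ?thesis ..
  qed
  \<comment> \<open>a uniform rotation of a fixed \<open>w\<close> is uniform\<close>
  have 2: "emeasure (phases I) {a \<in> space (phases I). \<forall>i\<in>I. a i * f i w \<in> B i} =
      (\<Prod>i\<in>I. emeasure unif_circle (B i))"
    if w: "\<And>i. i \<in> I \<Longrightarrow> cmod (f i w) = 1" for w
  proof -
    have C: "{c. c * f i w \<in> B i} \<in> sets borel" if "i \<in> I" for i
      using measurable_sets[of "\<lambda>c. c * f i w" borel borel "B i"] B[OF that] by (simp add: vimage_def)
    have "{a \<in> space (phases I). \<forall>i\<in>I. a i * f i w \<in> B i} = (\<Pi>\<^sub>E i\<in>I. {c. c * f i w \<in> B i})"
      by (auto simp: space_PiM PiE_iff extensional_def)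
    also have "emeasure (phases I) \<dots> = (\<Prod>i\<in>I. emeasure unif_circle {c. c * f i w \<in> B i})"
      using C assms(2) by (intro phases.emeasure_PiM) auto
    also have "\<dots> = (\<Prod>i\<in>I. emeasure unif_circle (B i))"
      using emeasure_unif_circle_rotate[OF w B] by (intro prod.cong) (auto simp: mult.commute)
    finally show ?thesis .
  qed
  have AE_a: "AE a in phases I. \<forall>i\<in>I. cmod (a i) = 1"
    using assms(2) by (intro AE_finite_allI phases.AE_component AE_unif_circle_norm) auto
  have AE_w: "AE w in P. \<forall>i\<in>I. cmod (f i w) = 1"
    using assms(2) norm by (intro AE_finite_allI) auto
  have "emeasure (phases I \<Otimes>\<^sub>M P) ?E =
      (\<integral>\<^sup>+a. emeasure P {w \<in> space P. \<forall>i\<in>I. a i * f i w \<in> B i} \<partial>phases I)"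
    using E by (subst P.emeasure_pair_measure_alt)
      (auto intro!: nn_integral_cong arg_cong[where f = "emeasure P"] simp: space_pair_measure)
  also have "\<dots> = (\<integral>\<^sup>+a. emeasure P {w \<in> space P. \<forall>i\<in>I. f i w \<in> B i} \<partial>phases I)"
    using AE_a by (intro nn_integral_cong_AE) (auto elim!: eventually_mono simp: 1)
  finally have L: "emeasure (phases I \<Otimes>\<^sub>M P) ?E = emeasure P {w \<in> space P. \<forall>i\<in>I. f i w \<in> B i}"
    by (simp add: phases.P.emeasure_space_1)
  have "emeasure (phases I \<Otimes>\<^sub>M P) ?E =
      (\<integral>\<^sup>+w. emeasure (phases I) {a \<in> space (phases I). \<forall>i\<in>I. a i * f i w \<in> B i} \<partial>P)"
    using E by (subst PA.emeasure_pair_measure_alt2)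
      (auto intro!: nn_integral_cong arg_cong[where f = "emeasure (phases I)"] simp: space_pair_measure)
  also have "\<dots> = (\<integral>\<^sup>+w. (\<Prod>i\<in>I. emeasure unif_circle (B i)) \<partial>P)"
    using AE_w by (intro nn_integral_cong_AE) (auto elim!: eventually_mono simp: 2)
  finally show ?thesis using L by (simp add: P.emeasure_space_1)
qed

section \<open>Uniform points on the circles\<close>

lemma sets_nat_lborel:
  "sets (count_space UNIV \<Otimes>\<^sub>M (lborel :: real measure)) = sets (count_space (UNIV :: nat set) \<Otimes>\<^sub>M borel)"
  by (intro sets_pair_measure_cong) auto

lemma emeasure_nat_lborel_Times:
  "S \<in> sets borel \<Longrightarrow>
    emeasure (count_space (UNIV :: nat set) \<Otimes>\<^sub>M lborel) (J \<times> S) = emeasure (count_space UNIV) J * emeasure lborel S"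
  by (intro lborel.emeasure_pair_measure_Times) auto

lemma circles_eq_UN: "circles v = (\<Union>j. {j} \<times> {0..<v j})"
  by (auto simp: circles_def)

lemma sets_circles: "circles v \<in> sets (count_space UNIV \<Otimes>\<^sub>M borel)"
  unfolding circles_eq_UN by (intro sets.countable_UN) auto

lemma emeasure_circles:
  assumes "v \<in> nabla'"
  shows "emeasure (count_space UNIV \<Otimes>\<^sub>M lborel) (circles v) = 1"
proof -
  have v: "v sums 1" "\<And>j. 0 \<le> v j" using assms by (auto simp: nabla'_def)
  have "emeasure (count_space UNIV \<Otimes>\<^sub>M lborel) (circles v) =
      (\<Sum>j. emeasure (count_space UNIV \<Otimes>\<^sub>M lborel) ({j} \<times> {0..<v j}))"
    unfolding circles_eq_UN
    by (intro suminf_emeasure[symmetric]) (auto simp: disjoint_family_on_def)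
  also have "\<dots> = (\<Sum>j. ennreal (v j))"
    using v(2) by (simp add: emeasure_nat_lborel_Times)
  also have "\<dots> = ennreal 1"
    using v by (intro suminf_ennreal_eq) auto
  finally show ?thesis by simp
qed

lemma emeasure_unif_circles:
  assumes "v \<in> nabla'" "B \<in> sets (count_space UNIV \<Otimes>\<^sub>M borel)"
  shows "emeasure (unif_circles v) B = emeasure (count_space UNIV \<Otimes>\<^sub>M lborel) (circles v \<inter> B)"
  using assms sets_circles[of v]
  by (simp add: unif_circles_def emeasure_uniform_measure sets_nat_lborel emeasure_circles
      divide_ennreal_def)

lemma emeasure_unif_circles_UNIV:
  assumes "v \<in> nabla'"
  shows "emeasure (unif_circles v) UNIV = 1"
  using emeasure_unif_circles[OF assms, of UNIV] emeasure_circles[OF assms]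
    sets.top[of "count_space (UNIV :: nat set) \<Otimes>\<^sub>M (borel :: real measure)"]
  by (simp add: space_pair_measure)

lemma emeasure_unif_circles_arc:
  assumes "v \<in> nabla'"
  shows "emeasure (unif_circles v) ({j} \<times> {a..<b}) =
    ennreal (if max 0 a \<le> min (v j) b then min (v j) b - max 0 a else 0)"
proof -
  have "circles v \<inter> {j} \<times> {a..<b} = {j} \<times> {max 0 a..<min (v j) b}"
    by (auto simp: circles_def)
  then show ?thesis
    using assms by (auto simp: emeasure_unif_circles emeasure_nat_lborel_Times)
qed

locale virtual_perm_sample =
  P: prob_space p + prob_space \<Omega>
  for \<Omega> :: "'a measure" and p :: "(nat \<Rightarrow> real) measure"
    and y :: "'a \<Rightarrow> nat \<Rightarrow> real" and x :: "'a \<Rightarrow> nat \<Rightarrow> nat \<times> real" +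
  assumes sets_p: "sets p = sets nabla'_algebra"
    and generates: "generates_virtual_perm \<Omega> p y x"
begin

lemma space_p: "space p = nabla'"
  using sets_eq_imp_space_eq[OF sets_p]
  by (simp add: nabla'_algebra_def space_restrict_space space_PiM)

lemma measurable_component_p [measurable]: "(\<lambda>v. v j) \<in> borel_measurable p"
proof -
  have "(\<lambda>v. v j) \<in> borel_measurable nabla'_algebra"
    unfolding nabla'_algebra_def
    by (intro measurable_restrict_space1 measurable_component_singleton) simp
  then show ?thesis using measurable_cong_sets[OF sets_p refl] by blast
qed

lemma measurable_y: "y \<in> measurable \<Omega> p"
  and measurable_x: "(\<lambda>\<omega>. x \<omega> k) \<in> measurable \<Omega> (count_space UNIV \<Otimes>\<^sub>M borel)"
  using generates by (auto simp: generates_virtual_perm_def)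

text \<open>The almost sure properties of the sample only need events of this form, where some of the points
  fall into one and the same set.\<close>

lemma emeasure_sample_in:
  assumes A: "A \<in> sets p" and B: "B \<in> sets (count_space UNIV \<Otimes>\<^sub>M borel)" and K: "finite K"
  shows "emeasure \<Omega> {\<omega> \<in> space \<Omega>. y \<omega> \<in> A \<and> (\<forall>k\<in>K. x \<omega> k \<in> B)} =
    (\<integral>\<^sup>+v\<in>A. emeasure (unif_circles v) B ^ card K \<partial>p)"
proof -
  obtain n where n: "K \<subseteq> {..<n}" using K finite_nat_bounded by blast
  define C where "C k = (if k \<in> K then B else UNIV)" for k
  have U: "UNIV \<in> sets (count_space (UNIV :: nat set) \<Otimes>\<^sub>M (borel :: real measure))"
    using sets.top[of "count_space (UNIV :: nat set) \<Otimes>\<^sub>M (borel :: real measure)"]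
    by (simp add: space_pair_measure)
  have "{\<omega> \<in> space \<Omega>. y \<omega> \<in> A \<and> (\<forall>k\<in>K. x \<omega> k \<in> B)} =
      {\<omega> \<in> space \<Omega>. y \<omega> \<in> A \<and> (\<forall>k<n. x \<omega> k \<in> C k)}"
    using n by (auto simp: C_def)
  also have "emeasure \<Omega> \<dots> = (\<integral>\<^sup>+v\<in>A. (\<Prod>k<n. emeasure (unif_circles v) (C k)) \<partial>p)"
    using generates A B U unfolding generates_virtual_perm_def C_def by simp
  also have "\<dots> = (\<integral>\<^sup>+v\<in>A. emeasure (unif_circles v) B ^ card K \<partial>p)"
  proof (rule nn_integral_cong)
    fix v assume "v \<in> space p"
    then have v: "v \<in> nabla'" by (simp add: space_p)
    have "(\<Prod>k<n. emeasure (unif_circles v) (C k)) =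
        (\<Prod>k<n. if k \<in> K then emeasure (unif_circles v) B else 1)"
      by (intro prod.cong) (auto simp: C_def emeasure_unif_circles_UNIV[OF v])
    also have "\<dots> = emeasure (unif_circles v) B ^ card K"
      using n by (simp add: prod.inter_restrict[symmetric] Int_absorb1)
    finally show "(\<Prod>k<n. emeasure (unif_circles v) (C k)) * indicator A v =
        emeasure (unif_circles v) B ^ card K * indicator A v" by simp
  qed
  finally show ?thesis .
qed

lemma AE_sample_notin:
  assumes A: "A \<in> sets p" and B: "B \<in> sets (count_space UNIV \<Otimes>\<^sub>M borel)"
    and 0: "\<And>v. v \<in> A \<Longrightarrow> emeasure (unif_circles v) B = 0"
  shows "AE \<omega> in \<Omega>. \<not> (y \<omega> \<in> A \<and> x \<omega> k \<in> B)"
proof -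
  have "(\<integral>\<^sup>+v\<in>A. emeasure (unif_circles v) B ^ card {k} \<partial>p) = (\<integral>\<^sup>+v. 0 \<partial>p)"
    by (intro nn_integral_cong) (auto simp: 0 split: split_indicator)
  then have "emeasure \<Omega> {\<omega> \<in> space \<Omega>. y \<omega> \<in> A \<and> x \<omega> k \<in> B} = 0"
    using emeasure_sample_in[OF A B, of "{k}"] by simp
  moreover have "{\<omega> \<in> space \<Omega>. y \<omega> \<in> A \<and> x \<omega> k \<in> B} \<in> sets \<Omega>"
  proof -
    have "{\<omega> \<in> space \<Omega>. y \<omega> \<in> A \<and> x \<omega> k \<in> B} =
        (y -` A \<inter> space \<Omega>) \<inter> ((\<lambda>\<omega>. x \<omega> k) -` B \<inter> space \<Omega>)" by auto
    then show ?thesis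
      using measurable_sets[OF measurable_y A] measurable_sets[OF measurable_x B] by simp
  qed
  ultimately show ?thesis
    by (intro AE_I'[of "{\<omega> \<in> space \<Omega>. y \<omega> \<in> A \<and> x \<omega> k \<in> B}"]) (auto simp: null_sets_def)
qed

lemma AE_position_pos: "AE \<omega> in \<Omega>. 0 < snd (x \<omega> k)"
proof -
  let ?B = "(UNIV :: nat set) \<times> {..(0::real)}"
  have B: "?B \<in> sets (count_space UNIV \<Otimes>\<^sub>M borel)" by auto
  have 0: "emeasure (unif_circles v) ?B = 0" if "v \<in> space p" for v
  proof -
    have "emeasure (unif_circles v) ?B = emeasure (count_space UNIV \<Otimes>\<^sub>M lborel) (circles v \<inter> ?B)"
      using that B by (intro emeasure_unif_circles) (auto simp: space_p)
    also have "\<dots> \<le> emeasure (count_space UNIV \<Otimes>\<^sub>M lborel) ((UNIV :: nat set) \<times> {0::real})"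
      by (intro emeasure_mono) (auto simp: circles_def)
    also have "\<dots> = 0" by (subst emeasure_nat_lborel_Times) auto
    finally show ?thesis by simp
  qed
  have "AE \<omega> in \<Omega>. \<not> (y \<omega> \<in> space p \<and> x \<omega> k \<in> ?B)"
    by (rule AE_sample_notin[OF sets.top B 0])
  then show ?thesis
    using AE_space
  proof eventually_elim
    case (elim \<omega>)
    then show ?case
      using measurable_space[OF measurable_y] by (cases "x \<omega> k") auto
  qed
qed

text \<open>Only products of an event for \<open>y\<close> and an event for \<open>x\<close> have a prescribed probability. The event that a
  point lies beyond the end of its circle is a countable union of such products, since a rational number
  separates the end from the point.\<close>

lemma AE_position_le: "AE \<omega> in \<Omega>. snd (x \<omega> k) \<le> y \<omega> (fst (x \<omega> k))"
proof -
  have "AE \<omega> in \<Omega>. \<not> (y \<omega> \<in> {v \<in> space p. v j < real_of_rat q} \<and> x \<omega> k \<in> {j} \<times> {real_of_rat q<..})"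
    for j :: nat and q :: rat
  proof (rule AE_sample_notin)
    fix v assume v: "v \<in> {v \<in> space p. v j < real_of_rat q}"
    then have "circles v \<inter> {j} \<times> {real_of_rat q<..} = {}" by (auto simp: circles_def)
    then show "emeasure (unif_circles v) ({j} \<times> {real_of_rat q<..}) = 0"
      using v by (subst emeasure_unif_circles) (auto simp: space_p)
  qed auto
  then have "AE \<omega> in \<Omega>. \<forall>j q. \<not> (y \<omega> \<in> {v \<in> space p. v j < real_of_rat q} \<and>
      x \<omega> k \<in> {j} \<times> {real_of_rat q<..})"
    by (simp only: AE_all_countable) blast
  then show ?thesis
    using AE_space
  proof eventually_elim
    case (elim \<omega>)
    show ?case
    proof (rule ccontr)
      assume "\<not> ?case"
      then obtain q where "y \<omega> (fst (x \<omega> k)) < real_of_rat q" "real_of_rat q < snd (x \<omega> k)"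
        using of_rat_dense by (metis not_le)
      then show False
        using elim(1)[rule_format, of "fst (x \<omega> k)" q] measurable_space[OF measurable_y elim(2)]
        by (cases "x \<omega> k") auto
    qed
  qed
qed

text \<open>Cut every circle into cells of length at most \<open>1 / m\<close>. Coinciding points lie in the same cell. Given the
  perimeters, both points lie in the cell \<open>c\<close> with probability \<open>(U c)\<^sup>2 \<le> U c / m\<close>, where \<open>U c\<close> is the
  probability that a single point does, and the \<open>U c\<close> add up to 1.\<close>

lemma emeasure_coincide_le:
  assumes "k \<noteq> l" "0 < m"
  shows "emeasure \<Omega> {\<omega> \<in> space \<Omega>. x \<omega> k = x \<omega> l} \<le> ennreal (1 / real m)"
proof -
  \<comment> \<open>the number of the circle and of the cell in it, encoded as one natural number\<close>
  define cell where "cell q = prod_encode (fst q, int_encode \<lfloor>snd q * real m\<rfloor>)"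
    for q :: "nat \<times> real"
  define D where "D c = cell -` {c}" for c
  have D_eq: "\<exists>j a. D c = {j} \<times> {a..<a + 1 / real m}" for c
  proof -
    obtain j i where c: "c = prod_encode (j, int_encode i)"
      by (metis int_decode_inverse prod_decode_inverse surj_pair)
    have "D c = {j} \<times> {real_of_int i / real m..<real_of_int i / real m + 1 / real m}"
      using assms(2)
      by (auto simp: D_def cell_def c int_encode_eq floor_eq_iff field_simps)
    then show ?thesis by blast
  qed
  let ?U = "\<lambda>c v. emeasure (unif_circles v) (D c)"
  have D_sets: "D c \<in> sets (count_space UNIV \<Otimes>\<^sub>M borel)" for c
    using D_eq[of c] by auto
  have U_le: "?U c v \<le> ennreal (1 / real m)" if "v \<in> space p" for c v
    using D_eq[of c] that by (auto simp: emeasure_unif_circles_arc space_p intro!: ennreal_leI)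
  have U_meas: "?U c \<in> borel_measurable p" for c
  proof -
    obtain j a where D: "D c = {j} \<times> {a..<a + 1 / real m}" using D_eq by blast
    have "(\<lambda>v. ennreal (if max 0 a \<le> min (v j) (a + 1 / real m)
        then min (v j) (a + 1 / real m) - max 0 a else 0)) \<in> borel_measurable p"
      by measurable
    then show ?thesis
      by (rule measurable_cong[THEN iffD1, rotated]) (simp add: D space_p emeasure_unif_circles_arc)
  qed
  have U_sum: "(\<Sum>c. ?U c v) = 1" if "v \<in> space p" for v
  proof -
    have "(\<Sum>c. ?U c v) = emeasure (unif_circles v) (\<Union>c. D c)"
      using D_sets by (intro suminf_emeasure)
        (auto simp: D_def disjoint_family_on_def unif_circles_def sets_nat_lborel)
    also have "(\<Union>c. D c) = UNIV" by (auto simp: D_def)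
    finally show ?thesis using that by (simp add: emeasure_unif_circles_UNIV space_p)
  qed
  let ?E = "\<lambda>c. {\<omega> \<in> space \<Omega>. y \<omega> \<in> space p \<and> (\<forall>i\<in>{k, l}. x \<omega> i \<in> D c)}"
  have E_sets: "?E c \<in> sets \<Omega>" for c
  proof -
    have "?E c = ((\<lambda>\<omega>. x \<omega> k) -` D c \<inter> space \<Omega>) \<inter> ((\<lambda>\<omega>. x \<omega> l) -` D c \<inter> space \<Omega>)"
      using measurable_space[OF measurable_y] by auto
    then show ?thesis using measurable_sets[OF measurable_x D_sets] by simp
  qed
  have "emeasure \<Omega> {\<omega> \<in> space \<Omega>. x \<omega> k = x \<omega> l} \<le> emeasure \<Omega> (\<Union>c. ?E c)"
    using E_sets measurable_space[OF measurable_y] by (intro emeasure_mono) (auto simp: D_def)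
  also have "\<dots> \<le> (\<Sum>c. emeasure \<Omega> (?E c))"
    using E_sets by (intro emeasure_subadditive_countably) auto
  also have "\<dots> = (\<Sum>c. \<integral>\<^sup>+v. ?U c v ^ 2 \<partial>p)"
  proof -
    have "emeasure \<Omega> (?E c) = (\<integral>\<^sup>+v. ?U c v ^ 2 \<partial>p)" for c
      unfolding emeasure_sample_in[OF sets.top D_sets finite.insertI[OF finite.insertI[OF finite.emptyI]]]
      using assms(1) by (intro nn_integral_cong) (simp add: power2_eq_square)
    then show ?thesis by simp
  qed
  also have "\<dots> = (\<integral>\<^sup>+v. (\<Sum>c. ?U c v ^ 2) \<partial>p)"
    unfolding power2_eq_square
    by (intro nn_integral_suminf[symmetric] borel_measurable_times_ennreal U_meas)
  also have "\<dots> \<le> (\<integral>\<^sup>+v. ennreal (1 / real m) \<partial>p)"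
  proof (rule nn_integral_mono)
    fix v assume v: "v \<in> space p"
    have "(\<Sum>c. ?U c v ^ 2) \<le> (\<Sum>c. ennreal (1 / real m) * ?U c v)"
      using U_le[OF v] by (intro suminf_le) (auto simp: power2_eq_square intro: mult_right_mono)
    also have "\<dots> = ennreal (1 / real m)"
      using U_sum[OF v] by simp
    finally show "(\<Sum>c. ?U c v ^ 2) \<le> ennreal (1 / real m)" .
  qed
  also have "\<dots> = ennreal (1 / real m)" by (simp add: P.emeasure_space_1)
  finally show ?thesis .
qed

lemma AE_sample_distinct:
  assumes "k \<noteq> l"
  shows "AE \<omega> in \<Omega>. x \<omega> k \<noteq> x \<omega> l"
proof -
  let ?E = "{\<omega> \<in> space \<Omega>. x \<omega> k = x \<omega> l}"
  have E: "?E \<in> sets \<Omega>"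
  proof -
    have fst: "(\<lambda>\<omega>. real (fst (x \<omega> i))) \<in> borel_measurable \<Omega>" for i
      by (rule measurable_compose[OF measurable_compose[OF measurable_x measurable_fst]]) simp
    have snd: "(\<lambda>\<omega>. snd (x \<omega> i)) \<in> borel_measurable \<Omega>" for i
      by (rule measurable_compose[OF measurable_x measurable_snd])
    have "?E = {\<omega> \<in> space \<Omega>. real (fst (x \<omega> k)) = real (fst (x \<omega> l))} \<inter>
        {\<omega> \<in> space \<Omega>. snd (x \<omega> k) = snd (x \<omega> l)}"
      by (auto simp: prod_eq_iff)
    also have "\<dots> \<in> sets \<Omega>"
      by (intro sets.Int borel_measurable_eq fst snd)
    finally show ?thesis .
  qed
  have "(\<lambda>m. ennreal (1 / real (Suc m))) \<longlonglongrightarrow> ennreal 0"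
    by (intro tendsto_ennrealI LIMSEQ_Suc[OF lim_const_over_n])
  moreover have "emeasure \<Omega> ?E \<le> ennreal (1 / real (Suc m))" for m
    using emeasure_coincide_le[OF assms, of "Suc m"] by simp
  ultimately have "emeasure \<Omega> ?E \<le> ennreal 0"
    by (intro LIMSEQ_le_const) auto
  then show ?thesis
    using E by (intro AE_I'[of ?E]) (auto simp: null_sets_def)
qed

lemma AE_generic_sample: "AE \<omega> in \<Omega>. generic_sample (y \<omega>) (x \<omega>)"
proof -
  have "AE \<omega> in \<Omega>. \<forall>k l. k \<noteq> l \<longrightarrow> x \<omega> k \<noteq> x \<omega> l"
    unfolding AE_all_countable using AE_sample_distinct by auto
  moreover have "AE \<omega> in \<Omega>. \<forall>k. 0 < snd (x \<omega> k)" "AE \<omega> in \<Omega>. \<forall>k. snd (x \<omega> k) \<le> y \<omega> (fst (x \<omega> k))"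
    unfolding AE_all_countable using AE_position_pos AE_position_le by auto
  ultimately show ?thesis
    by eventually_elim (auto simp: generic_sample_def inj_def)
qed

end

section \<open>The law of the phases along the edges\<close>

text \<open>When several indices minimise the distance, \<open>arg_min\<close> picks one by a choice that depends only on
  the set of minimisers, hence on an element of the finite set \<open>Pow {..<n}\<close>. Thus measurability
  holds everywhere and not only up to a null set, as is required of random variables.\<close>

lemma measurable_circle_perm:
  assumes Y: "\<And>j. (\<lambda>w. Y w j) \<in> borel_measurable L"
    and X: "\<And>k. (\<lambda>w. X w k) \<in> measurable L (count_space UNIV \<Otimes>\<^sub>M borel)"
  shows "(\<lambda>w. circle_perm (Y w) (X w) n k) \<in> measurable L (count_space UNIV)"
proof (cases "k < n")
  case False
  then show ?thesis by (simp add: circle_perm_def)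
next
  case True
  have c [measurable]: "(\<lambda>w. fst (X w i)) \<in> measurable L (count_space UNIV)" for i
    by (rule measurable_compose[OF X measurable_fst])
  have t [measurable]: "(\<lambda>w. snd (X w i)) \<in> borel_measurable L" for i
    by (rule measurable_compose[OF X measurable_snd])
  have per [measurable]: "(\<lambda>w. Y w (fst (X w k))) \<in> borel_measurable L"
    by (rule measurable_compose_countable[OF Y c])
  define d where "d w i = ccw_dist (Y w (fst (X w k))) (snd (X w k)) (snd (X w i))" for w i
  define P where "P w i \<longleftrightarrow> i < n \<and> fst (X w i) = fst (X w k)" for w i
  have d [measurable]: "(\<lambda>w. d w i) \<in> borel_measurable L" for i
    unfolding d_def ccw_dist_def by measurable
  have P [measurable]: "Measurable.pred L (\<lambda>w. P w i)" for i
  proof -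
    have "Measurable.pred L (\<lambda>w. \<exists>j. fst (X w i) = j \<and> fst (X w k) = j)"
      by measurable
    then show ?thesis unfolding P_def by (cases "i < n") (simp_all add: eq_commute)
  qed
  have cand [measurable]: "Measurable.pred L (\<lambda>w. is_arg_min (d w) (P w) i)" for i
    unfolding is_arg_min_def by measurable
  have eq: "circle_perm (Y w) (X w) n k = i \<longleftrightarrow>
      (\<exists>S\<in>Pow {..<n}. (SOME j. j \<in> S) = i \<and> (\<forall>j<n. j \<in> S \<longleftrightarrow> is_arg_min (d w) (P w) j))"
    for w i
  proof -
    let ?S = "{j. is_arg_min (d w) (P w) j}"
    have S: "?S \<subseteq> {..<n}" by (auto simp: is_arg_min_def P_def)
    have arg: "circle_perm (Y w) (X w) n k = (SOME j. j \<in> ?S)"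
      using True by (simp add: circle_perm_def arg_min_def d_def[abs_def] P_def[abs_def])
    have uniq: "S = ?S" if "S \<subseteq> {..<n}" "\<forall>j<n. j \<in> S \<longleftrightarrow> is_arg_min (d w) (P w) j" for S
      using that S by blast
    show ?thesis
    proof
      assume "circle_perm (Y w) (X w) n k = i"
      with arg have "(SOME j. j \<in> ?S) = i" by simp
      with S show "\<exists>S\<in>Pow {..<n}. (SOME j. j \<in> S) = i \<and> (\<forall>j<n. j \<in> S \<longleftrightarrow> is_arg_min (d w) (P w) j)"
        by (intro bexI[of _ ?S]) simp_all
    next
      assume "\<exists>S\<in>Pow {..<n}. (SOME j. j \<in> S) = i \<and> (\<forall>j<n. j \<in> S \<longleftrightarrow> is_arg_min (d w) (P w) j)"
      then obtain S where "S \<subseteq> {..<n}" "(SOME j. j \<in> S) = i" "\<forall>j<n. j \<in> S \<longleftrightarrow> is_arg_min (d w) (P w) j"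
        by blast
      with uniq[of S] arg show "circle_perm (Y w) (X w) n k = i" by simp
    qed
  qed
  have "Measurable.pred L (\<lambda>w. circle_perm (Y w) (X w) n k = i)" for i
    unfolding eq
    by (intro pred_intros_finite(4) pred_intros_conj1' pred_intros_countable(1) pred_intros_imp'
      pred_intros_logic(6) cand) simp_all
  from predE[OF this] show ?thesis
    by (simp add: measurable_count_space_eq2_countable vimage_def Int_def conj_commute)
qed

lemma measurable_edge_phase:
  assumes Y: "\<And>j. (\<lambda>w. Y w j) \<in> borel_measurable L"
    and X: "\<And>k. (\<lambda>w. X w k) \<in> measurable L (count_space UNIV \<Otimes>\<^sub>M borel)"
    and U: "\<And>j. (\<lambda>w. U w j) \<in> borel_measurable L"
    and V: "\<And>k. (\<lambda>w. V w k) \<in> borel_measurable L"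
  shows "(\<lambda>w. edge_phase (Y w) (X w) (U w) (V w) n k) \<in> borel_measurable L"
proof -
  note s = measurable_circle_perm[OF Y X, where n = n and k = k]
  note V [measurable]
  have [measurable]: "(\<lambda>w. V w (circle_perm (Y w) (X w) n k)) \<in> borel_measurable L"
    by (rule measurable_compose_countable[OF V s])
  have c: "(\<lambda>w. fst (X w k)) \<in> measurable L (count_space UNIV)"
    by (rule measurable_compose[OF X measurable_fst])
  have [measurable]: "(\<lambda>w. U w (fst (X w k))) \<in> borel_measurable L"
    by (rule measurable_compose_countable[OF U c])
  have t [measurable]: "(\<lambda>w. snd (X w i)) \<in> borel_measurable L" for i
    by (rule measurable_compose[OF X measurable_snd])
  have [measurable]: "(\<lambda>w. snd (X w (circle_perm (Y w) (X w) n k))) \<in> borel_measurable L"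
    by (rule measurable_compose_countable[OF t s])
  show ?thesis unfolding edge_phase_def by measurable
qed

lemma measurable_generic_sample:
  assumes Y: "\<And>j. (\<lambda>w. Y w j) \<in> borel_measurable L"
    and X: "\<And>k. (\<lambda>w. X w k) \<in> measurable L (count_space UNIV \<Otimes>\<^sub>M borel)"
  shows "{w \<in> space L. generic_sample (Y w) (X w)} \<in> sets L"
proof -
  have c: "(\<lambda>w. fst (X w k)) \<in> measurable L (count_space UNIV)" for k
    by (rule measurable_compose[OF X measurable_fst])
  have c' [measurable]: "(\<lambda>w. real (fst (X w k))) \<in> borel_measurable L" for k
    by (rule measurable_compose[OF c]) simp
  have t [measurable]: "(\<lambda>w. snd (X w i)) \<in> borel_measurable L" for i
    by (rule measurable_compose[OF X measurable_snd])
  have [measurable]: "(\<lambda>w. Y w (fst (X w k))) \<in> borel_measurable L" for k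
    by (rule measurable_compose_countable[OF Y c])
  have "generic_sample (Y w) (X w) \<longleftrightarrow> (\<forall>k. 0 < snd (X w k)) \<and>
      (\<forall>k. snd (X w k) \<le> Y w (fst (X w k))) \<and>
      (\<forall>k l. real (fst (X w k)) = real (fst (X w l)) \<and> snd (X w k) = snd (X w l) \<longrightarrow> k = l)" for w
    by (auto simp: generic_sample_def inj_def prod_eq_iff)
  then show ?thesis by (simp only:) measurable
qed

lemma AE_pair_fst:
  assumes "prob_space A" "prob_space B" "AE a in A. P a"
  shows "AE q in A \<Otimes>\<^sub>M B. P (fst q)"
proof -
  interpret B: prob_space B by fact
  obtain Z where Z: "{a \<in> space A. \<not> P a} \<subseteq> Z" "emeasure A Z = 0" "Z \<in> sets A"
    using assms(3) by (auto elim: AE_E)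
  have "emeasure (A \<Otimes>\<^sub>M B) (Z \<times> space B) = 0"
    using Z by (subst B.emeasure_pair_measure_Times) auto
  then show ?thesis
    using Z by (intro AE_I'[of "Z \<times> space B"]) (auto simp: null_sets_def space_pair_measure)
qed

lemma AE_pair_snd:
  assumes "prob_space A" "prob_space B" "AE b in B. P b"
  shows "AE q in A \<Otimes>\<^sub>M B. P (snd q)"
proof -
  interpret B: prob_space B by fact
  obtain Z where Z: "{b \<in> space B. \<not> P b} \<subseteq> Z" "emeasure B Z = 0" "Z \<in> sets B"
    using assms(3) by (auto elim: AE_E)
  have "emeasure (A \<Otimes>\<^sub>M B) (space A \<times> Z) = 0"
    using Z by (subst B.emeasure_pair_measure_Times) auto
  then show ?thesis
    using Z by (intro AE_I'[of "space A \<times> Z"]) (auto simp: null_sets_def space_pair_measure)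
qed

lemma AE_phases_norm: "AE w in phases (UNIV :: nat set). \<forall>k. cmod (w k) = 1"
  unfolding AE_all_countable
  by (intro allI phases.AE_component AE_unif_circle_norm) auto

context generic_sample
begin

text \<open>To multiply the edge phase at every \<open>k\<close> by \<open>a k\<close>, multiply \<open>v k\<close> by the product of \<open>a\<close> over the points
  behind \<open>k\<close> on its circle and \<open>u j\<close> by the product of \<open>a\<close> over the whole circle: a step
  ahead picks up exactly the factor \<open>a k\<close>, and so does the wrapping step, where the whole product is divided by
  the product over all points but the last.\<close>

lemma edge_phase_rotation:
  assumes a: "\<And>k. k < n \<Longrightarrow> cmod (a k) = 1"
  shows "\<exists>d c. (\<forall>j. cmod (d j) = 1) \<and> (\<forall>k. cmod (c k) = 1) \<and>
    (\<forall>u v. \<forall>k<n. edge_phase y x (\<lambda>j. d j * u j) (\<lambda>k. c k * v k) n k = a k * edge_phase y x u v n k)"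
proof -
  \<comment> \<open>the points behind \<open>k\<close> on its circle\<close>
  define R where "R k = {i. i < n \<and> circ i = circ k \<and> pos i < pos k}" for k
  define c where "c k = (\<Prod>i\<in>R k. a i)" for k
  define d where "d j = (\<Prod>i\<in>cycle_supp x n j. a i)" for j
  have fin: "finite (R k)" for k by (simp add: R_def)
  have c_norm: "cmod (c k) = 1" for k
    unfolding c_def prod_norm[symmetric] by (intro prod.neutral) (auto simp: R_def a)
  have d_norm: "cmod (d j) = 1" for j
    unfolding d_def prod_norm[symmetric] by (intro prod.neutral) (auto simp: cycle_supp_def a)
  have "edge_phase y x (\<lambda>j. d j * u j) (\<lambda>k. c k * v k) n k = a k * edge_phase y x u v n k"
    if k: "k < n" for u v k
  proof -
    have s: "circ (\<sigma> n k) = circ k" using fst_circle_perm[OF k] .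
    have kR: "k \<notin> R k" by (simp add: R_def)
    have c0: "c k \<noteq> 0" using c_norm[of k] by auto
    show ?thesis using k
    proof (cases rule: succ_cases)
      case ahead
      have "R (\<sigma> n k) = insert k (R k)"
      proof (intro equalityI subsetI)
        fix i assume i: "i \<in> R (\<sigma> n k)"
        then have "pos i \<le> pos k" using ahead(2)[of i] s by (force simp: R_def)
        then show "i \<in> insert k (R k)"
          using i s sample_eqI[of i k] by (auto simp: R_def less_le)
      qed (use ahead k s in \<open>auto simp: R_def\<close>)
      then have "c (\<sigma> n k) = a k * c k"
        using fin kR by (simp add: c_def)
      then show ?thesis using ahead c0 by (simp add: edge_phase_def)
    next
      case wrap
      have "R (\<sigma> n k) = {}" using wrap(3) s by (force simp: R_def)
      then have 1: "c (\<sigma> n k) = 1" by (simp add: c_def)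
      have "cycle_supp x n (circ k) = insert k (R k)"
      proof (intro equalityI subsetI)
        fix i assume i: "i \<in> cycle_supp x n (circ k)"
        then show "i \<in> insert k (R k)"
          using wrap(2)[of i] sample_eqI[of i k] by (auto simp: R_def cycle_supp_def less_le)
      qed (use k in \<open>auto simp: R_def cycle_supp_def\<close>)
      then have "d (circ k) = a k * c k"
        using fin kR by (simp add: c_def d_def)
      then show ?thesis using wrap(1) c0 1 by (simp add: edge_phase_def)
    qed
  qed
  then show ?thesis using c_norm d_norm by blast
qed

lemma emeasure_edge_phases:
  assumes B: "\<And>k. k < n \<Longrightarrow> B k \<in> sets borel"
  shows "emeasure (phases UNIV \<Otimes>\<^sub>M phases UNIV)
      {q \<in> space (phases UNIV \<Otimes>\<^sub>M phases UNIV). \<forall>k\<in>{..<n}. edge_phase y x (fst q) (snd q) n k \<in> B k} =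
    (\<Prod>k<n. emeasure unif_circle (B k))"
proof (rule emeasure_rotation_invariant)
  let ?R = "phases (UNIV :: nat set)"
  have R: "prob_space ?R" by (intro prob_space_PiM prob_space_unif_circle)
  show "prob_space (?R \<Otimes>\<^sub>M ?R)" by (rule prob_space_pair[OF R R])
  have comp: "(\<lambda>w. w k) \<in> borel_measurable ?R" for k
    using measurable_component_singleton[of k UNIV "\<lambda>_. unif_circle"]
      measurable_cong_sets[OF refl sets_unif_circle] by blast
  show "(\<lambda>q. edge_phase y x (fst q) (snd q) n k) \<in> borel_measurable (?R \<Otimes>\<^sub>M ?R)" for k
    by (intro measurable_edge_phase measurable_compose[OF measurable_fst comp]
        measurable_compose[OF measurable_snd comp] measurable_const) (auto simp: space_pair_measure)
  show "AE q in ?R \<Otimes>\<^sub>M ?R. cmod (edge_phase y x (fst q) (snd q) n k) = 1" for k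
    using AE_pair_fst[OF R R AE_phases_norm] AE_pair_snd[OF R R AE_phases_norm]
    by eventually_elim (simp add: edge_phase_def norm_mult norm_divide)
  show "\<exists>T\<in>measurable (?R \<Otimes>\<^sub>M ?R) (?R \<Otimes>\<^sub>M ?R). distr (?R \<Otimes>\<^sub>M ?R) (?R \<Otimes>\<^sub>M ?R) T = ?R \<Otimes>\<^sub>M ?R \<and>
      (\<forall>q\<in>space (?R \<Otimes>\<^sub>M ?R). \<forall>k\<in>{..<n}. edge_phase y x (fst (T q)) (snd (T q)) n k =
        a k * edge_phase y x (fst q) (snd q) n k)"
    if a: "\<And>k. k \<in> {..<n} \<Longrightarrow> cmod (a k) = 1" for a
  proof -
    obtain d c where d: "\<And>j. cmod (d j) = 1" and c: "\<And>k. cmod (c k) = 1"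
      and rot: "\<And>u v k. k < n \<Longrightarrow>
        edge_phase y x (\<lambda>j. d j * u j) (\<lambda>k. c k * v k) n k = a k * edge_phase y x u v n k"
      using edge_phase_rotation[of n a] a by auto
    have meas: "(\<lambda>w i. e i * w i) \<in> measurable ?R ?R" for e :: "nat \<Rightarrow> complex"
      by (rule measurable_PiM_single') (auto simp: space_PiM intro!: borel_measurable_times comp)
    define T where "T = (\<lambda>(u, v). ((\<lambda>j. d j * u j), (\<lambda>k. c k * v k)) :: (nat \<Rightarrow> complex) \<times> (nat \<Rightarrow> complex))"
    have "distr ?R ?R (\<lambda>w i. d i * w i) \<Otimes>\<^sub>M distr ?R ?R (\<lambda>w i. c i * w i) =
        distr (?R \<Otimes>\<^sub>M ?R) (?R \<Otimes>\<^sub>M ?R) T"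
      unfolding T_def
      by (rule pair_measure_distr[OF meas meas])
        (simp add: distr_phases_rotate[OF c] prob_space_imp_sigma_finite R)
    then have "distr (?R \<Otimes>\<^sub>M ?R) (?R \<Otimes>\<^sub>M ?R) T = ?R \<Otimes>\<^sub>M ?R"
      by (simp add: distr_phases_rotate[OF c] distr_phases_rotate[OF d])
    moreover have "T \<in> measurable (?R \<Otimes>\<^sub>M ?R) (?R \<Otimes>\<^sub>M ?R)"
      unfolding T_def split_beta'
      by (intro measurable_Pair measurable_compose[OF measurable_fst meas]
          measurable_compose[OF measurable_snd meas])
    ultimately show ?thesis
      by (intro bexI[of _ T]) (auto simp: T_def rot split_beta)
  qed
qed (use B in auto)

end

section \<open>Coupling\<close>

lemma indep_elements_distr:
  assumes "prob_space \<Omega>" "indep_elements \<Omega> S X T Y"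
  shows "distr \<Omega> (S \<Otimes>\<^sub>M T) (\<lambda>\<omega>. (X \<omega>, Y \<omega>)) = distr \<Omega> S X \<Otimes>\<^sub>M distr \<Omega> T Y"
proof (rule pair_measure_eqI[symmetric])
  interpret prob_space \<Omega> by fact
  have X: "X \<in> measurable \<Omega> S" and Y: "Y \<in> measurable \<Omega> T"
    and ind: "indep_set (sets (vimage_algebra (space \<Omega>) X S)) (sets (vimage_algebra (space \<Omega>) Y T))"
    using assms(2) by (auto simp: indep_elements_def)
  show "sigma_finite_measure (distr \<Omega> S X)" "sigma_finite_measure (distr \<Omega> T Y)"
    using prob_space_distr[OF X] prob_space_distr[OF Y] by (auto intro: prob_space_imp_sigma_finite)
  fix A B assume "A \<in> sets (distr \<Omega> S X)" "B \<in> sets (distr \<Omega> T Y)"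
  then have A: "A \<in> sets S" and B: "B \<in> sets T" by auto
  let ?A = "X -` A \<inter> space \<Omega>" and ?B = "Y -` B \<inter> space \<Omega>"
  have "prob (?A \<inter> ?B) = prob ?A * prob ?B"
    by (rule indep_setD[OF ind]) (auto intro!: in_vimage_algebra A B)
  then have "emeasure \<Omega> ?A * emeasure \<Omega> ?B = emeasure \<Omega> (?A \<inter> ?B)"
    by (simp add: emeasure_eq_measure ennreal_mult)
  also have "?A \<inter> ?B = (\<lambda>\<omega>. (X \<omega>, Y \<omega>)) -` (A \<times> B) \<inter> space \<Omega>" by auto
  finally show "emeasure (distr \<Omega> S X) A * emeasure (distr \<Omega> T Y) B =
      emeasure (distr \<Omega> (S \<Otimes>\<^sub>M T) (\<lambda>\<omega>. (X \<omega>, Y \<omega>))) (A \<times> B)"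
    using X Y A B by (simp add: emeasure_distr measurable_Pair)
qed simp

lemma iid_unif_circle_distr:
  assumes "prob_space \<Omega>" "iid_unif_circle \<Omega> UNIV u"
  shows "distr \<Omega> (\<Pi>\<^sub>M j\<in>UNIV. borel) (\<lambda>\<omega> j. u j \<omega>) = phases UNIV"
proof -
  interpret prob_space \<Omega> by fact
  have ind: "indep_vars (\<lambda>_. borel) u UNIV" and d: "\<And>i. distr \<Omega> borel (u i) = unif_circle"
    using assms(2) by (auto simp: iid_unif_circle_def)
  then have "random_variable borel (u i)" for i by (auto simp: indep_vars_def)
  with ind show ?thesis
    using indep_vars_iff_distr_eq_PiM[where I = UNIV and M' = "\<lambda>_. borel" and X = u] by (simp add: d restrict_UNIV)
qed

lemma iid_unif_circleI:
  fixes f :: "'i \<Rightarrow> 'a \<Rightarrow> complex"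
  assumes "prob_space N" "finite I" "I \<noteq> {}"
    and f: "\<And>i. i \<in> I \<Longrightarrow> f i \<in> borel_measurable N"
    and rect: "\<And>B. (\<And>i. i \<in> I \<Longrightarrow> B i \<in> sets borel) \<Longrightarrow>
      emeasure N {w \<in> space N. \<forall>i\<in>I. f i w \<in> B i} = (\<Prod>i\<in>I. emeasure unif_circle (B i))"
  shows "iid_unif_circle N I f"
proof -
  interpret prob_space N by fact
  have marginal: "distr N borel (f i) = unif_circle" if i: "i \<in> I" for i
  proof (rule measure_eqI)
    fix A assume "A \<in> sets (distr N borel (f i))"
    then have A: "A \<in> sets borel" by simp
    have "emeasure (distr N borel (f i)) A =
        emeasure N {w \<in> space N. \<forall>j\<in>I. f j w \<in> (if j = i then A else UNIV)}"
      using A f[OF i] i by (subst emeasure_distr) (auto intro!: arg_cong[where f = "emeasure N"])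
    also have "\<dots> = (\<Prod>j\<in>I. emeasure unif_circle (if j = i then A else UNIV))"
      using A by (intro rect) auto
    also have "\<dots> = (\<Prod>j\<in>I. if j = i then emeasure unif_circle A else 1)"
      using prob_space.emeasure_space_1[OF prob_space_unif_circle] by (intro prod.cong) auto
    also have "\<dots> = emeasure unif_circle A"
      using i assms(2) by simp
    finally show "emeasure (distr N borel (f i)) A = emeasure unif_circle A" .
  qed simp
  have F: "(\<lambda>w. \<lambda>i\<in>I. f i w) \<in> measurable N (\<Pi>\<^sub>M i\<in>I. borel)"
    using f by (rule measurable_restrict)
  have "distr N (\<Pi>\<^sub>M i\<in>I. borel) (\<lambda>w. \<lambda>i\<in>I. f i w) = phases I"
  proof (rule phases.PiM_eqI[OF assms(2)])
    show "sets (distr N (\<Pi>\<^sub>M i\<in>I. borel) (\<lambda>w. \<lambda>i\<in>I. f i w)) = sets (phases I)"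
      by (simp add: sets_phases)
    fix A :: "'i \<Rightarrow> complex set" assume A: "\<And>i. i \<in> I \<Longrightarrow> A i \<in> sets unif_circle"
    have "emeasure (distr N (\<Pi>\<^sub>M i\<in>I. borel) (\<lambda>w. \<lambda>i\<in>I. f i w)) (Pi\<^sub>E I A) =
        emeasure N {w \<in> space N. \<forall>i\<in>I. f i w \<in> A i}"
      using A assms(2) F by (subst emeasure_distr)
        (auto intro!: arg_cong[where f = "emeasure N"] sets_PiM_I_finite)
    also have "\<dots> = (\<Prod>i\<in>I. emeasure unif_circle (A i))"
      using A by (intro rect) auto
    finally show "emeasure (distr N (\<Pi>\<^sub>M i\<in>I. borel) (\<lambda>w. \<lambda>i\<in>I. f i w)) (Pi\<^sub>E I A) =
      (\<Prod>i\<in>I. emeasure unif_circle (A i))" .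
  qed
  also have "phases I = (\<Pi>\<^sub>M i\<in>I. distr N borel (f i))"
    by (intro PiM_cong) (auto simp: marginal)
  finally have "indep_vars (\<lambda>_. borel) f I"
    using indep_vars_iff_distr_eq_PiM'[OF assms(3), where M' = "\<lambda>_. borel" and X = f] f by simp
  with marginal show ?thesis by (auto simp: iid_unif_circle_def)
qed

locale virtual_perm_phases = virtual_perm_sample \<Omega> p y x
  for \<Omega> :: "'a measure" and p y x +
  fixes u :: "nat \<Rightarrow> 'a \<Rightarrow> complex"
  assumes iid_u: "iid_unif_circle \<Omega> UNIV u"
    and indep_u: "indep_elements \<Omega>
      (p \<Otimes>\<^sub>M (\<Pi>\<^sub>M k\<in>UNIV. count_space UNIV \<Otimes>\<^sub>M borel)) (\<lambda>\<omega>. (y \<omega>, x \<omega>))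
      (\<Pi>\<^sub>M j\<in>UNIV. borel) (\<lambda>\<omega> j. u j \<omega>)"
begin

abbreviation R :: "(nat \<Rightarrow> complex) measure" where "R \<equiv> phases UNIV"
abbreviation N :: "('a \<times> (nat \<Rightarrow> complex)) measure" where "N \<equiv> \<Omega> \<Otimes>\<^sub>M R"

abbreviation Z :: "nat \<Rightarrow> nat \<Rightarrow> 'a \<times> (nat \<Rightarrow> complex) \<Rightarrow> complex" where
  "Z n k q \<equiv> edge_phase (y (fst q)) (x (fst q)) (\<lambda>j. u j (fst q)) (snd q) n k"

lemma prob_space_R: "prob_space R"
  by (intro prob_space_PiM prob_space_unif_circle)

lemma prob_space_N: "prob_space N"
  by (intro prob_space_pair prob_space_R prob_space_axioms)

lemma prob_extension_N: "prob_extension N \<Omega> fst"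
proof -
  have "distr N \<Omega> fst = \<Omega>"
  proof (rule measure_eqI)
    fix A assume "A \<in> sets (distr N \<Omega> fst)"
    then have A: "A \<in> sets \<Omega>" by simp
    have "fst -` A \<inter> space N = A \<times> space R"
      using sets.sets_into_space[OF A] by (auto simp: space_pair_measure)
    then show "emeasure (distr N \<Omega> fst) A = emeasure \<Omega> A"
      using A by (simp add: emeasure_distr phases.P.emeasure_pair_measure_Times phases.P.emeasure_space_1)
  qed simp
  then show ?thesis using prob_space_N by (simp add: prob_extension_def)
qed

lemma measurable_u: "u j \<in> borel_measurable \<Omega>"
  using iid_u by (auto simp: iid_unif_circle_def indep_vars_def)

lemma measurable_R_component: "(\<lambda>w. w k) \<in> borel_measurable R"
  using measurable_component_singleton[of k UNIV "\<lambda>_. unif_circle"]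
    measurable_cong_sets[OF refl sets_unif_circle] by blast

lemma measurable_y_component: "(\<lambda>\<omega>. y \<omega> j) \<in> borel_measurable \<Omega>"
  by (rule measurable_compose[OF measurable_y measurable_component_p])

lemmas measurable_N =
  measurable_compose[OF measurable_fst measurable_y_component]
  measurable_compose[OF measurable_fst measurable_x]
  measurable_compose[OF measurable_fst measurable_u]
  measurable_compose[OF measurable_snd measurable_R_component]

lemma measurable_Z: "Z n k \<in> borel_measurable N"
  by (intro measurable_edge_phase measurable_N)

lemma random_mat_phase_mat:
  "random_mat N n (\<lambda>q. phase_mat (y (fst q)) (x (fst q)) (\<lambda>j. u j (fst q)) (snd q) n)"
proof -
  have "(\<lambda>q. if i = circle_perm (y (fst q)) (x (fst q)) n k then Z n k q else 0) \<in> borel_measurable N"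
    for i k
  proof -
    have s: "(\<lambda>q. circle_perm (y (fst q)) (x (fst q)) n k) \<in> measurable N (count_space UNIV)"
      by (intro measurable_circle_perm measurable_N)
    have "(\<lambda>q. if i = j then Z n k q else 0) \<in> borel_measurable N" for j
      using measurable_Z by (cases "i = j") auto
    then show ?thesis by (rule measurable_compose_countable[OF _ s])
  qed
  then show ?thesis by (simp add: random_mat_def)
qed

lemma AE_generic_phases:
  "AE q in N. generic_phases (y (fst q)) (x (fst q)) (\<lambda>j. u j (fst q)) (snd q)"
proof -
  have u: "AE \<omega> in \<Omega>. \<forall>j. cmod (u j \<omega>) = 1 \<and> u j \<omega> \<noteq> 1"
    unfolding AE_all_countable
  proof
    fix j
    have d: "distr \<Omega> borel (u j) = unif_circle"
      using iid_u by (simp add: iid_unif_circle_def)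
    have "AE w in distr \<Omega> borel (u j). cmod w = 1 \<and> w \<noteq> 1"
      unfolding d using AE_unif_circle_norm AE_unif_circle_neq_1 by eventually_elim simp
    then show "AE \<omega> in \<Omega>. cmod (u j \<omega>) = 1 \<and> u j \<omega> \<noteq> 1"
      by (rule AE_distrD[OF measurable_u])
  qed
  have "AE \<omega> in \<Omega>. generic_sample (y \<omega>) (x \<omega>) \<and> (\<forall>j. cmod (u j \<omega>) = 1 \<and> u j \<omega> \<noteq> 1)"
    using AE_generic_sample u by eventually_elim simp
  from AE_pair_fst[OF prob_space_axioms prob_space_R this]
    AE_pair_snd[OF prob_space_axioms prob_space_R AE_phases_norm]
  show ?thesis
    by eventually_elim (auto simp: generic_phases_def generic_phases_axioms_def)
qed

text \<open>The sample, \<open>u\<close> and \<open>v\<close> are independent, so \<open>N\<close> can be replaced by the product of their laws. Fixing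
  the sample first, almost every fibre contributes the same value.\<close>

lemma emeasure_edge_phase:
  assumes B: "\<And>k. k \<in> {..<n} \<Longrightarrow> B k \<in> sets borel"
  shows "emeasure N {q \<in> space N. \<forall>k\<in>{..<n}. Z n k q \<in> B k} = (\<Prod>k<n. emeasure unif_circle (B k))"
proof -
  define S where "S = p \<Otimes>\<^sub>M (\<Pi>\<^sub>M k\<in>(UNIV :: nat set). (count_space (UNIV :: nat set) \<Otimes>\<^sub>M (borel :: real measure)))"
  define X where "X \<omega> = (y \<omega>, x \<omega>)" for \<omega>
  define U where "U \<omega> = (\<lambda>j. u j \<omega>)" for \<omega>
  define Q where "Q = distr \<Omega> S X"
  have X: "X \<in> measurable \<Omega> S"
    using indep_u by (simp add: indep_elements_def S_def X_def[abs_def])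
  interpret Q: prob_space Q unfolding Q_def by (rule prob_space_distr[OF X])
  have law: "distr \<Omega> (S \<Otimes>\<^sub>M (\<Pi>\<^sub>M j\<in>UNIV. borel)) (\<lambda>\<omega>. (X \<omega>, U \<omega>)) = Q \<Otimes>\<^sub>M R"
    using indep_elements_distr[OF prob_space_axioms indep_u]
    by (simp add: iid_unif_circle_distr[OF prob_space_axioms iid_u] Q_def S_def X_def[abs_def] U_def[abs_def])
  have U: "U \<in> measurable \<Omega> R"
    using indep_u measurable_cong_sets[OF refl sets_phases]
    by (auto simp: indep_elements_def U_def[abs_def])
  let ?L = "(Q \<Otimes>\<^sub>M R) \<Otimes>\<^sub>M R"
  have sets_QR: "sets (Q \<Otimes>\<^sub>M R) = sets (S \<Otimes>\<^sub>M R)"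
    unfolding Q_def by (intro sets_pair_measure_cong) auto
  have XU: "(\<lambda>\<omega>. (X \<omega>, U \<omega>)) \<in> measurable \<Omega> (Q \<Otimes>\<^sub>M R)"
    using measurable_Pair[OF X U] measurable_cong_sets[OF refl sets_QR] by blast
  have "sets (Q \<Otimes>\<^sub>M R) = sets (S \<Otimes>\<^sub>M (\<Pi>\<^sub>M j\<in>UNIV. borel))"
    unfolding Q_def by (intro sets_pair_measure_cong sets_distr sets_phases)
  then have "distr \<Omega> (Q \<Otimes>\<^sub>M R) (\<lambda>\<omega>. (X \<omega>, U \<omega>)) =
      distr \<Omega> (S \<Otimes>\<^sub>M (\<Pi>\<^sub>M j\<in>UNIV. borel)) (\<lambda>\<omega>. (X \<omega>, U \<omega>))"
    by (intro distr_cong refl)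
  also note law
  finally have "distr \<Omega> (Q \<Otimes>\<^sub>M R) (\<lambda>\<omega>. (X \<omega>, U \<omega>)) = Q \<Otimes>\<^sub>M R" .
  then have L: "distr N ?L (\<lambda>(\<omega>, v). ((X \<omega>, U \<omega>), v)) = ?L"
    using pair_measure_distr[OF XU measurable_ident_sets[OF refl, of R]]
    by (simp add: distr_id[unfolded id_def] prob_space_imp_sigma_finite[OF prob_space_R])
  have S1: "(\<lambda>s. fst s j) \<in> borel_measurable S" for j
    unfolding S_def by (rule measurable_compose[OF measurable_fst measurable_component_p])
  have S2: "(\<lambda>s. snd s k) \<in> measurable S (count_space UNIV \<Otimes>\<^sub>M borel)" for k
    unfolding S_def
    by (rule measurable_compose[OF measurable_snd measurable_component_singleton]) simp
  have Q1: "(\<lambda>s. fst s j) \<in> borel_measurable Q" for j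
    using S1 by (simp add: Q_def)
  have Q2: "(\<lambda>s. snd s k) \<in> measurable Q (count_space UNIV \<Otimes>\<^sub>M borel)" for k
    using S2 by (simp add: Q_def)
  let ?F = "\<lambda>s u v. \<forall>k\<in>{..<n}. edge_phase (fst s) (snd s) u v n k \<in> B k"
  define W where "W = {w \<in> space ?L. ?F (fst (fst w)) (snd (fst w)) (snd w)}"
  have W: "W \<in> sets ?L"
    unfolding W_def
  proof (rule sets.sets_Collect_finite_All)
    fix k assume k: "k \<in> {..<n}"
    have "(\<lambda>w. edge_phase (fst (fst (fst w))) (snd (fst (fst w))) (snd (fst w)) (snd w) n k)
        \<in> borel_measurable ?L"
      by (intro measurable_edge_phase
          measurable_compose[OF measurable_compose[OF measurable_fst measurable_fst] Q1]
          measurable_compose[OF measurable_compose[OF measurable_fst measurable_fst] Q2]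
          measurable_compose[OF measurable_compose[OF measurable_fst measurable_snd] measurable_R_component]
          measurable_compose[OF measurable_snd measurable_R_component])
    from measurable_sets[OF this B[OF k]]
    show "{w \<in> space ?L. edge_phase (fst (fst (fst w))) (snd (fst (fst w))) (snd (fst w)) (snd w) n k \<in> B k}
        \<in> sets ?L"
      by (simp add: vimage_def Int_def conj_commute)
  qed simp
  have \<Phi>: "(\<lambda>(\<omega>, v). ((X \<omega>, U \<omega>), v)) \<in> measurable N ?L"
    unfolding split_beta'
    by (intro measurable_Pair measurable_compose[OF measurable_fst XU] measurable_snd)
  have generic: "AE s in Q. generic_sample (fst s) (snd s)"
    unfolding Q_def
    by (subst AE_distr_iff[OF X measurable_generic_sample[OF S1 S2]]) (simp add: X_def AE_generic_sample)
  have fibre: "(\<integral>\<^sup>+w. emeasure R (Pair (s, w) -` W) \<partial>R) = (\<Prod>k<n. emeasure unif_circle (B k))"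
    if s: "s \<in> space Q" and gen: "generic_sample (fst s) (snd s)" for s
  proof -
    let ?i = "\<lambda>q. ((s, fst q), snd q)"
    let ?G = "?i -` W \<inter> space (R \<Otimes>\<^sub>M R)"
    have i: "?i \<in> measurable (R \<Otimes>\<^sub>M R) ?L"
      by (rule measurable_Pair[OF measurable_Pair[OF measurable_const[OF s] measurable_fst] measurable_snd])
    have "?i q \<in> W \<longleftrightarrow> ?F s (fst q) (snd q)" if "q \<in> space (R \<Otimes>\<^sub>M R)" for q
      using measurable_space[OF i that] by (simp add: W_def)
    then have G: "{q \<in> space (R \<Otimes>\<^sub>M R). ?F s (fst q) (snd q)} = ?G"
      by (simp only: vimage_def Int_def mem_Collect_eq) blast
    have "emeasure (R \<Otimes>\<^sub>M R) ?G = (\<integral>\<^sup>+w. emeasure R (Pair w -` ?G) \<partial>R)"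
      using measurable_sets[OF i W] by (rule phases.P.emeasure_pair_measure_alt)
    also have "\<dots> = (\<integral>\<^sup>+w. emeasure R (Pair (s, w) -` W) \<partial>R)"
    proof (intro nn_integral_cong arg_cong[where f = "emeasure R"])
      fix w assume "w \<in> space R"
      then show "Pair w -` ?G = Pair (s, w) -` W"
        using sets.sets_into_space[OF W] by (auto simp: space_pair_measure)
    qed
    finally show ?thesis
      using generic_sample.emeasure_edge_phases[OF gen, of n B] B by (simp add: G)
  qed
  have "(case q of (\<omega>, v) \<Rightarrow> ((X \<omega>, U \<omega>), v)) \<in> W \<longleftrightarrow> (\<forall>k\<in>{..<n}. Z n k q \<in> B k)"
    if "q \<in> space N" for q
    using measurable_space[OF \<Phi> that] by (simp add: W_def X_def U_def split_beta)
  then have "{q \<in> space N. \<forall>k\<in>{..<n}. Z n k q \<in> B k} =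
      (\<lambda>(\<omega>, v). ((X \<omega>, U \<omega>), v)) -` W \<inter> space N"
    by (simp only: vimage_def Int_def mem_Collect_eq) blast
  also have "emeasure N \<dots> = emeasure (distr N ?L (\<lambda>(\<omega>, v). ((X \<omega>, U \<omega>), v))) W"
    using \<Phi> W by (rule emeasure_distr[symmetric])
  also have "\<dots> = emeasure ?L W" by (simp only: L)
  also have "\<dots> = (\<integral>\<^sup>+q. emeasure R (Pair q -` W) \<partial>(Q \<Otimes>\<^sub>M R))"
    using W by (rule phases.P.emeasure_pair_measure_alt)
  also have "\<dots> = (\<integral>\<^sup>+s. \<integral>\<^sup>+w. emeasure R (Pair (s, w) -` W) \<partial>R \<partial>Q)"
    by (rule phases.P.nn_integral_fst[symmetric]) (rule phases.P.measurable_emeasure_Pair[OF W])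
  also have "\<dots> = (\<integral>\<^sup>+s. (\<Prod>k<n. emeasure unif_circle (B k)) \<partial>Q)"
    using generic AE_space by (intro nn_integral_cong_AE, eventually_elim) (rule fibre)
  also have "\<dots> = (\<Prod>k<n. emeasure unif_circle (B k))"
    by (simp add: Q.emeasure_space_1)
  finally show ?thesis .
qed

end

theorem corollary10:
  fixes \<Omega> :: "'a measure"
    and p :: "(nat \<Rightarrow> real) measure"
    and y :: "'a \<Rightarrow> nat \<Rightarrow> real"
    and x :: "'a \<Rightarrow> nat \<Rightarrow> nat \<times> real"
    and u :: "nat \<Rightarrow> 'a \<Rightarrow> complex"
  assumes "prob_space p" and "sets p = sets nabla'_algebra"
    and "prob_space \<Omega>"
    and "generates_virtual_perm \<Omega> p y x"
    and "iid_unif_circle \<Omega> UNIV u"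
    and "indep_elements \<Omega>
           (p \<Otimes>\<^sub>M (\<Pi>\<^sub>M k\<in>UNIV. count_space UNIV \<Otimes>\<^sub>M borel)) (\<lambda>\<omega>. (y \<omega>, x \<omega>))
           (\<Pi>\<^sub>M j\<in>UNIV. borel) (\<lambda>\<omega> j. u j \<omega>)"
  shows "\<exists>(N :: ('a \<times> (nat \<Rightarrow> complex)) measure) \<pi> (M :: nat \<Rightarrow> 'a \<times> (nat \<Rightarrow> complex) \<Rightarrow> complex mat).
     prob_extension N \<Omega> \<pi> \<and>
     (\<forall>n\<ge>1. random_mat N n (M n)) \<and>
     (AE \<omega> in N. modified_virtual_perm (\<lambda>n. M n \<omega>)) \<and>
     (\<forall>n\<ge>1.
        (AE \<omega> in N. modified_perm_mat_of n (circle_perm (y (\<pi> \<omega>)) (x (\<pi> \<omega>)) n) (M n \<omega>)) \<and>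
        iid_unif_circle N {..<n}
          (\<lambda>j \<omega>. M n \<omega> $$ (circle_perm (y (\<pi> \<omega>)) (x (\<pi> \<omega>)) n j, j)) \<and>
        (AE \<omega> in N. \<forall>j. cycle_length (x (\<pi> \<omega>)) n j > 0 \<longrightarrow>
           u j (\<pi> \<omega>) =
             (\<Prod>k\<in>cycle_supp (x (\<pi> \<omega>)) n j. M n \<omega> $$ (circle_perm (y (\<pi> \<omega>)) (x (\<pi> \<omega>)) n k, k))))"
proof -
  interpret virtual_perm_phases \<Omega> p y x u
    using assms
    by (intro virtual_perm_phases.intro virtual_perm_sample.intro virtual_perm_sample_axioms.intro
        virtual_perm_phases_axioms.intro)
  let ?M = "\<lambda>n q. phase_mat (y (fst q)) (x (fst q)) (\<lambda>j. u j (fst q)) (snd q) n"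
  have "iid_unif_circle N {..<n}
      (\<lambda>j q. ?M n q $$ (circle_perm (y (fst q)) (x (fst q)) n j, j))" if "1 \<le> n" for n
  proof (rule iid_unif_circleI)
    have entry: "(\<lambda>q. ?M n q $$ (circle_perm (y (fst q)) (x (fst q)) n k, k)) = Z n k" if "k \<in> {..<n}" for k
      using that by (auto simp: phase_mat_circle_perm)
    show "(\<lambda>q. ?M n q $$ (circle_perm (y (fst q)) (x (fst q)) n k, k)) \<in> borel_measurable N"
      if "k \<in> {..<n}" for k
      unfolding entry[OF that] by (rule measurable_Z)
    show "emeasure N {q \<in> space N. \<forall>k\<in>{..<n}. ?M n q $$ (circle_perm (y (fst q)) (x (fst q)) n k, k) \<in> B k} =
        (\<Prod>k\<in>{..<n}. emeasure unif_circle (B k))"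
      if "\<And>k. k \<in> {..<n} \<Longrightarrow> B k \<in> sets borel" for B
      using emeasure_edge_phase[of n B] that by (simp add: phase_mat_circle_perm cong: conj_cong)
  qed (use that prob_space_N in \<open>auto simp: lessThan_empty_iff\<close>)
  moreover have "AE q in N. modified_virtual_perm (\<lambda>n. ?M n q)"
    using AE_generic_phases by eventually_elim (rule generic_phases.modified_virtual_perm_phase_mat)
  moreover have "AE q in N. modified_perm_mat_of n (circle_perm (y (fst q)) (x (fst q)) n) (?M n q)" for n
    using AE_generic_phases by eventually_elim (rule generic_phases.modified_perm_phase_mat)
  moreover have "AE q in N. \<forall>j. cycle_length (x (fst q)) n j > 0 \<longrightarrow>
      u j (fst q) = (\<Prod>k\<in>cycle_supp (x (fst q)) n j. ?M n q $$ (circle_perm (y (fst q)) (x (fst q)) n k, k))"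
    for n
    using AE_generic_phases
  proof eventually_elim
    case (elim q)
    then interpret generic_phases "y (fst q)" "x (fst q)" "\<lambda>j. u j (fst q)" "snd q" .
    have "(\<Prod>k\<in>cycle_supp (x (fst q)) n j. ?M n q $$ (circle_perm (y (fst q)) (x (fst q)) n k, k)) =
        (\<Prod>k\<in>cycle_supp (x (fst q)) n j. edge_phase (y (fst q)) (x (fst q)) (\<lambda>j. u j (fst q)) (snd q) n k)"
      for j
      by (intro prod.cong) (auto simp: cycle_supp_def phase_mat_circle_perm)
    then show ?case
      using prod_edge_phase by (auto simp: cycle_length_def card_gt_0_iff)
  qed
  ultimately show ?thesis
    using prob_extension_N random_mat_phase_mat by (intro exI[of _ N] exI[of _ fst] exI[of _ ?M]) blast
qed

end
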